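(* Let $P_0,\dots,P_N\in\mathbb{C}[X_0,\dots,X_N]$ be homogeneous polynomials of the same degree $d\ge 1$ whose only common zero in $\mathbb{C}^{N+1}$ is the origin. Let $m,n\in\mathbb{N}$. The partial differential equation $$\sum_{i=0}^{N}P_i(X)\frac{\partial A}{\partial Y_i}(Y,X)=0$$ admits a non-zero bi-homogeneous solution $A\in\mathbb{C}[Y,X]_{m,n}$ if and only if $dm\le n$.
   Context: $N\ge 2$ is a fixed integer, $X=(X_0,\dots,X_N)$, $Y=(Y_0,\dots,Y_N)$, and $\mathbb{C}[Y,X]_{m,n}$ is the space of polynomials that are homogeneous of degree $m$ in $Y$ and homogeneous of degree $n$ in $X$. $\mathbb{N}$ contains $0$. *)

theory Defs
  imports Complex_Main "HOL-Library.Poly_Mapping"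
begin

text \<open>
  Polynomials with complex coefficients in variables of type \<open>'v\<close>: finitely supported maps from
  monomials (exponent vectors) to coefficients, with the convolution product of
  \<open>Poly_Mapping\<close>.
\<close>

type_synonym 'v monomial = "'v \<Rightarrow>\<^sub>0 nat"
type_synonym 'v cpoly = "'v monomial \<Rightarrow>\<^sub>0 complex"

definition polys_over :: "'v set \<Rightarrow> 'v cpoly set" where
  "polys_over V = {p. \<forall>\<mu>\<in>Poly_Mapping.keys p. Poly_Mapping.keys \<mu> \<subseteq> V}"

definition degree_in :: "'v set \<Rightarrow> 'v monomial \<Rightarrow> nat" where
  "degree_in V \<mu> = (\<Sum>v\<in>V. Poly_Mapping.lookup \<mu> v)"

text \<open>The zero polynomial is homogeneous of every degree.\<close>

definition homogeneous_in :: "'v set \<Rightarrow> nat \<Rightarrow> 'v cpoly \<Rightarrow> bool" where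
  "homogeneous_in V k p \<longleftrightarrow> (\<forall>\<mu>\<in>Poly_Mapping.keys p. degree_in V \<mu> = k)"

definition eval_cpoly :: "('v \<Rightarrow> complex) \<Rightarrow> 'v cpoly \<Rightarrow> complex" where
  "eval_cpoly z p =
     (\<Sum>\<mu>\<in>Poly_Mapping.keys p. Poly_Mapping.lookup p \<mu> *
        (\<Prod>v\<in>Poly_Mapping.keys \<mu>. z v ^ Poly_Mapping.lookup \<mu> v))"

text \<open>
  The subtraction of exponents is truncated, but a monomial not containing \<open>v\<close> contributes with
  coefficient \<open>0\<close>.
\<close>

definition partial_deriv :: "'v \<Rightarrow> 'v cpoly \<Rightarrow> 'v cpoly" where
  "partial_deriv v p =
     (\<Sum>\<mu>\<in>Poly_Mapping.keys p.
        Poly_Mapping.single (\<mu> - Poly_Mapping.single v 1)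
          (of_nat (Poly_Mapping.lookup \<mu> v) * Poly_Mapping.lookup p \<mu>))"

datatype var = X nat | Y nat

definition X_vars :: "nat \<Rightarrow> var set" where
  "X_vars N = X ` {..N}"

definition Y_vars :: "nat \<Rightarrow> var set" where
  "Y_vars N = Y ` {..N}"

definition bihomogeneous :: "nat \<Rightarrow> nat \<Rightarrow> nat \<Rightarrow> var cpoly set" where
  "bihomogeneous N m n =
     {A \<in> polys_over (Y_vars N \<union> X_vars N).
        homogeneous_in (Y_vars N) m A \<and> homogeneous_in (X_vars N) n A}"

end

theory Submission
  imports Defs "HOL-Probability.Distributions" "Jordan_Normal_Form.Determinant"
begin

text \<open>
Write \<open>D = \<Sum>\<^sub>i P\<^sub>i(X) \<partial>/\<partial>Y\<^sub>i\<close>. A solution for \<open>d m \<le> n\<close> is easy to write down: some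
\<open>P\<^sub>i\<close> is not zero, \<open>D\<close> kills \<open>P\<^sub>i Y\<^sub>j - P\<^sub>j Y\<^sub>i\<close> for any \<open>j \<noteq> i\<close>, and so it kills
\<open>(P\<^sub>i Y\<^sub>j - P\<^sub>j Y\<^sub>i)\<^sup>m X\<^sub>0\<^bsup>n-dm\<^esup>\<close>.

The bound \<open>d m \<le> n\<close> is a positivity argument. For \<open>P\<^sub>i = X\<^sub>i\<close> it is the fact that a highest weight
vector of \<open>sl\<^sub>2\<close> has non-negative weight: \<open>D\<close> and \<open>F = \<Sum>\<^sub>i Y\<^sub>i \<partial>/\<partial>X\<^sub>i\<close> are adjoint to each other
for the Gaussian inner product and \<open>[D, F]\<close> is the difference of the degrees in \<open>X\<close> and in \<open>Y\<close>,
whence \<open>\<parallel>F A\<parallel>\<^sup>2 = \<langle>A, D F A\<rangle> = (n - m) \<parallel>A\<parallel>\<^sup>2\<close> if \<open>D A = 0\<close>. In general, use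
\<open>z = P(X)\<close> as coordinates. The Gaussian inner product becomes the integral of
\<open>a cnj(b) |J|\<^sup>2 exp(-|P(X)|\<^sup>2 - |Y|\<^sup>2)\<close>, where \<open>J\<close> is the Jacobian determinant of \<open>P\<close>. It
converges because \<open>P\<close> vanishes only at the origin, so that \<open>|P(X)| \<ge> c |X|\<^sup>d\<close>. The field
\<open>\<partial>/\<partial>z\<^sub>i\<close> becomes \<open>J\<^sup>-\<^sup>1 w\<^sub>i\<close>, where \<open>w\<^sub>i\<close> (here \<open>adj_field i\<close>) has the cofactors of the
Jacobian matrix as its coefficients; the denominator is harmless, since \<open>J\<close> is absorbed by the
weight \<open>|J|\<^sup>2\<close>. The Euler field in \<open>z\<close> is \<open>1/d\<close> times the one in \<open>X\<close>. So the computation above,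
multiplied by \<open>J\<close>, gives for \<open>B = \<Sum>\<^sub>i Y\<^sub>i w\<^sub>i(A)\<close> the identity
\<open>d \<langle>B, B\<rangle> = (n - d m) \<langle>J A, J A\<rangle>\<close>, now with the weight \<open>exp(-|P(X)|\<^sup>2 - |Y|\<^sup>2)\<close>
(\<open>degree_bound\<close>).

Three facts carry this. The first is integration by parts against the weight
(\<open>integration_by_parts\<close>). The second is the Piola identity, which says that the fields \<open>w\<^sub>i\<close>
have divergence \<open>0\<close> (\<open>piola_identity\<close>). The third is \<open>J \<noteq> 0\<close>
(\<open>det_jacobian_nonzero\<close>): otherwise some non-trivial combination of the \<open>\<partial>/\<partial>X\<^sub>j\<close> with polynomial
coefficients would annihilate all \<open>P\<^sub>i\<close>, hence also the weight, and integration by parts forbids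
that.
\<close>

section \<open>Evaluation of polynomials\<close>

text \<open>
Reduces statements that are additive in the polynomial to single terms.
\<close>

lemma cpoly_induct [case_names zero monomial add]:
  fixes a :: "'v cpoly"
  assumes "Q 0" and "\<And>\<mu> c. Q (Poly_Mapping.single \<mu> c)" and "\<And>a b. Q a \<Longrightarrow> Q b \<Longrightarrow> Q (a + b)"
  shows "Q a"
proof -
  have eq: "a = (\<Sum>\<mu>\<in>Poly_Mapping.keys a. Poly_Mapping.single \<mu> (Poly_Mapping.lookup a \<mu>))"
    by (rule poly_mapping_eqI)
       (simp add: lookup_sum lookup_single when_def in_keys_iff)
  have "Q (\<Sum>\<mu>\<in>S. Poly_Mapping.single \<mu> (Poly_Mapping.lookup a \<mu>))" if "finite S" for S
    using that by (induction S) (auto intro: assms)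
  then show ?thesis by (subst eq) simp
qed

definition Var :: "'v \<Rightarrow> 'v cpoly" where
  "Var v = Poly_Mapping.single (Poly_Mapping.single v 1) 1"

definition eval_monomial :: "('v \<Rightarrow> complex) \<Rightarrow> 'v monomial \<Rightarrow> complex" where
  "eval_monomial z \<mu> = (\<Prod>v\<in>Poly_Mapping.keys \<mu>. z v ^ Poly_Mapping.lookup \<mu> v)"

lemma eval_monomial_superset:
  assumes "finite S" "Poly_Mapping.keys \<mu> \<subseteq> S"
  shows "eval_monomial z \<mu> = (\<Prod>v\<in>S. z v ^ Poly_Mapping.lookup \<mu> v)"
  unfolding eval_monomial_def
  by (rule prod.mono_neutral_left) (use assms in \<open>auto simp: in_keys_iff\<close>)

lemma eval_monomial_add: "eval_monomial z (\<mu> + \<nu>) = eval_monomial z \<mu> * eval_monomial z \<nu>"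
proof -
  let ?S = "Poly_Mapping.keys \<mu> \<union> Poly_Mapping.keys \<nu>"
  have "Poly_Mapping.keys (\<mu> + \<nu>) \<subseteq> ?S" by (rule Poly_Mapping.keys_add)
  then show ?thesis
    by (simp add: eval_monomial_superset[of ?S] lookup_add power_add prod.distrib)
qed

lemma eval_monomial_0 [simp]: "eval_monomial z 0 = 1"
  by (simp add: eval_monomial_def)

lemma eval_cpoly_superset:
  assumes "finite S" "Poly_Mapping.keys p \<subseteq> S"
  shows "eval_cpoly z p = (\<Sum>\<mu>\<in>S. Poly_Mapping.lookup p \<mu> * eval_monomial z \<mu>)"
  unfolding eval_cpoly_def eval_monomial_def
  by (rule sum.mono_neutral_left) (use assms in \<open>auto simp: in_keys_iff\<close>)

lemma eval_cpoly_single [simp]: "eval_cpoly z (Poly_Mapping.single \<mu> c) = c * eval_monomial z \<mu>"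
  by (simp add: eval_cpoly_superset[of "{\<mu>}"])

lemma eval_cpoly_0 [simp]: "eval_cpoly z 0 = 0"
  by (simp add: eval_cpoly_def)

lemma eval_cpoly_add [simp]: "eval_cpoly z (p + q) = eval_cpoly z p + eval_cpoly z q"
proof -
  let ?S = "Poly_Mapping.keys p \<union> Poly_Mapping.keys q"
  have "Poly_Mapping.keys (p + q) \<subseteq> ?S" by (rule Poly_Mapping.keys_add)
  then show ?thesis
    by (simp add: eval_cpoly_superset[of ?S] lookup_add distrib_right sum.distrib)
qed

lemma eval_cpoly_uminus [simp]: "eval_cpoly z (- p) = - eval_cpoly z p"
  using eval_cpoly_add[of z p "- p"] by (simp add: add_eq_0_iff)

lemma eval_cpoly_diff [simp]: "eval_cpoly z (p - q) = eval_cpoly z p - eval_cpoly z q"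
  using eval_cpoly_add[of z p "- q"] by simp

lemma eval_cpoly_mult [simp]: "eval_cpoly z (p * q) = eval_cpoly z p * eval_cpoly z q"
proof (induction p rule: cpoly_induct)
  case (monomial \<mu> c)
  show ?case
    by (induction q rule: cpoly_induct) (auto simp: mult_single eval_monomial_add distrib_left)
qed (auto simp: distrib_right)

lemma eval_cpoly_Var [simp]: "eval_cpoly z (Var v) = z v"
  by (simp add: Var_def eval_monomial_def)

lemma eval_cpoly_cong:
  assumes "p \<in> polys_over V" "\<And>v. v \<in> V \<Longrightarrow> z v = z' v"
  shows "eval_cpoly z p = eval_cpoly z' p"
proof -
  have "(\<Prod>v\<in>Poly_Mapping.keys \<mu>. z v ^ Poly_Mapping.lookup \<mu> v) =
      (\<Prod>v\<in>Poly_Mapping.keys \<mu>. z' v ^ Poly_Mapping.lookup \<mu> v)"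
    if "\<mu> \<in> Poly_Mapping.keys p" for \<mu>
  proof (rule prod.cong[OF refl])
    fix v assume "v \<in> Poly_Mapping.keys \<mu>"
    then have "v \<in> V" using assms(1) that unfolding polys_over_def by blast
    then show "z v ^ Poly_Mapping.lookup \<mu> v = z' v ^ Poly_Mapping.lookup \<mu> v"
      by (simp add: assms(2))
  qed
  then show ?thesis by (simp add: eval_cpoly_def)
qed

section \<open>Partial derivatives\<close>

text \<open>
The coefficient of \<open>\<nu>\<close> comes from the single exponent \<open>\<nu> + e\<^sub>v\<close>. The other exponents that the
truncated subtraction sends to \<open>\<nu>\<close> do not contain \<open>v\<close>.
\<close>

lemma lookup_partial_deriv:
  "Poly_Mapping.lookup (partial_deriv v p) \<nu> =
     of_nat (Suc (Poly_Mapping.lookup \<nu> v)) * Poly_Mapping.lookup p (\<nu> + Poly_Mapping.single v 1)"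
proof -
  let ?e = "Poly_Mapping.single v (1::nat)"
  have *: "(\<mu> - ?e = \<nu> \<and> Poly_Mapping.lookup \<mu> v \<noteq> 0) \<longleftrightarrow> \<mu> = \<nu> + ?e" for \<mu>
  proof
    assume h: "\<mu> - ?e = \<nu> \<and> Poly_Mapping.lookup \<mu> v \<noteq> 0"
    show "\<mu> = \<nu> + ?e"
      by (rule poly_mapping_eqI)
         (use h in \<open>auto simp: lookup_add lookup_minus lookup_single when_def\<close>)
  next
    assume "\<mu> = \<nu> + ?e"
    then show "\<mu> - ?e = \<nu> \<and> Poly_Mapping.lookup \<mu> v \<noteq> 0"
      by (auto simp: lookup_add)
  qed
  have "Poly_Mapping.lookup (partial_deriv v p) \<nu> =
     (\<Sum>\<mu>\<in>Poly_Mapping.keys p. if \<mu> = \<nu> + ?e then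
         of_nat (Poly_Mapping.lookup \<mu> v) * Poly_Mapping.lookup p \<mu> else 0)"
    unfolding partial_deriv_def lookup_sum lookup_single when_def
  proof (rule sum.cong[OF refl])
    fix \<mu>
    show "(if \<mu> - ?e = \<nu> then of_nat (Poly_Mapping.lookup \<mu> v) * Poly_Mapping.lookup p \<mu> else 0) =
        (if \<mu> = \<nu> + ?e then of_nat (Poly_Mapping.lookup \<mu> v) * Poly_Mapping.lookup p \<mu> else 0)"
      using *[of \<mu>] by (cases "\<mu> - ?e = \<nu>"; cases "\<mu> = \<nu> + ?e") simp_all
  qed
  also have "\<dots> = of_nat (Suc (Poly_Mapping.lookup \<nu> v)) * Poly_Mapping.lookup p (\<nu> + ?e)"
    by (simp add: lookup_add in_keys_iff)
  finally show ?thesis .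
qed

lemma partial_deriv_add: "partial_deriv v (p + q) = partial_deriv v p + partial_deriv v q"
  by (rule poly_mapping_eqI) (simp add: lookup_partial_deriv lookup_add algebra_simps)

lemma partial_deriv_0 [simp]: "partial_deriv v 0 = 0"
  by (rule poly_mapping_eqI) (simp add: lookup_partial_deriv)

lemma partial_deriv_single:
  "partial_deriv v (Poly_Mapping.single \<mu> c) =
     Poly_Mapping.single (\<mu> - Poly_Mapping.single v 1) (of_nat (Poly_Mapping.lookup \<mu> v) * c)"
  by (cases "c = 0") (simp_all add: partial_deriv_def)

lemma partial_deriv_commute: "partial_deriv u (partial_deriv v p) = partial_deriv v (partial_deriv u p)"
proof (cases "u = v")
  case False
  then show ?thesis
    by (intro poly_mapping_eqI)
       (simp add: lookup_partial_deriv lookup_add lookup_single_not_eq ac_simps)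
qed simp

lemma partial_deriv_mult: "partial_deriv v (p * q) = partial_deriv v p * q + p * partial_deriv v q"
proof (induction p rule: cpoly_induct)
  case (monomial \<mu> c)
  show ?case
  proof (induction q rule: cpoly_induct)
    case (monomial \<nu> b)
    let ?e = "Poly_Mapping.single v (1::nat)"
    have shift: "Poly_Mapping.single (\<alpha> - ?e + \<beta>) (of_nat (Poly_Mapping.lookup \<alpha> v) * x) =
          Poly_Mapping.single (\<alpha> + \<beta> - ?e) (of_nat (Poly_Mapping.lookup \<alpha> v) * x)"
      for \<alpha> \<beta> and x :: complex
    proof (cases "Poly_Mapping.lookup \<alpha> v = 0")
      case False
      then have "\<alpha> - ?e + \<beta> = \<alpha> + \<beta> - ?e"
        by (intro poly_mapping_eqI) (auto simp: lookup_add lookup_minus lookup_single when_def)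
      then show ?thesis by simp
    qed simp
    show ?case
      using shift[of \<mu> \<nu> "c * b"] shift[of \<nu> \<mu> "c * b"]
      by (simp add: mult_single partial_deriv_single lookup_add ac_simps distrib_left single_add
            distrib_right)
  qed (auto simp: algebra_simps partial_deriv_add)
qed (auto simp: algebra_simps partial_deriv_add)

lemma partial_deriv_Var: "partial_deriv u (Var v) = (if u = v then 1 else 0)"
  by (auto simp: Var_def partial_deriv_single lookup_single when_def)

lemma partial_deriv_not_occurring:
  assumes "p \<in> polys_over V" "v \<notin> V"
  shows "partial_deriv v p = 0"
  unfolding partial_deriv_def
proof (rule sum.neutral, safe)
  fix \<mu> assume "\<mu> \<in> Poly_Mapping.keys p"
  then have "v \<notin> Poly_Mapping.keys \<mu>" using assms by (auto simp: polys_over_def)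
  then show "Poly_Mapping.single (\<mu> - Poly_Mapping.single v 1)
      (of_nat (Poly_Mapping.lookup \<mu> v) * Poly_Mapping.lookup p \<mu>) = 0"
    by (simp add: in_keys_iff)
qed

lemma euler_identity:
  assumes "homogeneous_in V k p" and "finite V"
  shows "(\<Sum>v\<in>V. Var v * partial_deriv v p) = of_nat k * p"
proof -
  have single: "Var v * partial_deriv v (Poly_Mapping.single \<mu> c) =
      Poly_Mapping.single \<mu> (of_nat (Poly_Mapping.lookup \<mu> v) * c)" for v \<mu> c
  proof (cases "Poly_Mapping.lookup \<mu> v = 0")
    case False
    then have "Poly_Mapping.single v 1 + (\<mu> - Poly_Mapping.single v 1) = \<mu>"
      by (intro poly_mapping_eqI) (auto simp: lookup_add lookup_minus lookup_single when_def)
    then show ?thesis by (simp add: Var_def partial_deriv_single mult_single)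
  qed (simp add: Var_def partial_deriv_single)
  have lookup: "Poly_Mapping.lookup (Var v * partial_deriv v p) \<mu> =
      of_nat (Poly_Mapping.lookup \<mu> v) * Poly_Mapping.lookup p \<mu>" for v \<mu>
    by (induction p rule: cpoly_induct)
       (auto simp: single lookup_single when_def partial_deriv_add distrib_left lookup_add)
  show ?thesis
  proof (rule poly_mapping_eqI)
    fix \<mu>
    have "Poly_Mapping.lookup (of_nat k * p) \<mu> = of_nat k * Poly_Mapping.lookup p \<mu>"
      by (induction k) (auto simp: distrib_right lookup_add)
    moreover have "(\<Sum>v\<in>V. of_nat (Poly_Mapping.lookup \<mu> v) * Poly_Mapping.lookup p \<mu>) =
        of_nat k * Poly_Mapping.lookup p \<mu>"
      using assms(1)
      by (cases "\<mu> \<in> Poly_Mapping.keys p")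
         (auto simp: homogeneous_in_def degree_in_def in_keys_iff simp flip: sum_distrib_right of_nat_sum)
    ultimately show "Poly_Mapping.lookup (\<Sum>v\<in>V. Var v * partial_deriv v p) \<mu> =
        Poly_Mapping.lookup (of_nat k * p) \<mu>"
      by (simp add: lookup_sum lookup)
  qed
qed

lemma eval_monomial_split:
  "eval_monomial z \<mu> = z v ^ Poly_Mapping.lookup \<mu> v *
     (\<Prod>u\<in>Poly_Mapping.keys \<mu> - {v}. z u ^ Poly_Mapping.lookup \<mu> u)"
proof -
  have "eval_monomial z \<mu> = (\<Prod>u\<in>insert v (Poly_Mapping.keys \<mu>). z u ^ Poly_Mapping.lookup \<mu> u)"
    by (rule eval_monomial_superset) auto
  then show ?thesis by (simp add: prod.insert_remove)
qed

lemma has_field_derivative_eval_cpoly: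
  "((\<lambda>t. eval_cpoly (z(v := t)) p) has_field_derivative
      eval_cpoly (z(v := t)) (partial_deriv v p)) (at t)"
proof (induction p rule: cpoly_induct)
  case (monomial \<mu> c)
  define r where "r = (\<Prod>u\<in>Poly_Mapping.keys \<mu> - {v}. z u ^ Poly_Mapping.lookup \<mu> u)"
  have r: "(\<Prod>u\<in>Poly_Mapping.keys \<mu> - {v}. (z(v := s)) u ^ Poly_Mapping.lookup \<mu> u) = r" for s
    unfolding r_def by (rule prod.cong) auto
  have ev: "eval_monomial (z(v := s)) \<mu> = s ^ Poly_Mapping.lookup \<mu> v * r" for s
    using eval_monomial_split[of "z(v := s)" \<mu> v] r by simp
  have ev': "eval_monomial (z(v := s)) (\<mu> - Poly_Mapping.single v 1) =
      s ^ (Poly_Mapping.lookup \<mu> v - 1) * r" for s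
  proof -
    have "Poly_Mapping.keys (\<mu> - Poly_Mapping.single v 1) - {v} = Poly_Mapping.keys \<mu> - {v}"
      by (auto simp: in_keys_iff lookup_minus lookup_single_not_eq)
    then have "(\<Prod>u\<in>Poly_Mapping.keys (\<mu> - Poly_Mapping.single v 1) - {v}.
        (z(v := s)) u ^ Poly_Mapping.lookup (\<mu> - Poly_Mapping.single v 1) u) = r"
      unfolding r_def
      by (rule prod.cong) (auto simp: lookup_minus lookup_single when_def)
    then show ?thesis
      using eval_monomial_split[of "z(v := s)" "\<mu> - Poly_Mapping.single v 1" v]
      by (simp add: lookup_minus)
  qed
  show ?case
    unfolding partial_deriv_single eval_cpoly_single ev ev'
    by (auto intro!: derivative_eq_intros)
qed (auto simp: partial_deriv_add intro!: derivative_intros)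

text \<open>
Induction on the degree: if \<open>p\<close> vanishes as a function, then so do its partial derivatives, which
have smaller degree. So they are zero polynomials, and \<open>p\<close> is constant. Points are required to
vanish outside \<open>W\<close> because the integrals below see only such points.
\<close>

lemma eval_cpoly_zero_imp_zero:
  assumes "finite W" "p \<in> polys_over W"
    and "\<And>z. (\<And>v. v \<notin> W \<Longrightarrow> z v = 0) \<Longrightarrow> eval_cpoly z p = 0"
  shows "p = 0"
proof -
  obtain k where "\<forall>\<mu>\<in>Poly_Mapping.keys p. degree_in W \<mu> < k"
    using finite_nat_set_iff_bounded[of "degree_in W ` Poly_Mapping.keys p"] by auto
  then show ?thesis using assms(2,3)
  proof (induction k arbitrary: p)
    case 0
    then show ?case by simp
  next
    case (Suc k)
    have deriv0: "partial_deriv v p = 0" if v: "v \<in> W" for v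
    proof (rule Suc.IH)
      have keys: "\<nu> + Poly_Mapping.single v 1 \<in> Poly_Mapping.keys p"
        if "\<nu> \<in> Poly_Mapping.keys (partial_deriv v p)" for \<nu>
        using that by (auto simp: in_keys_iff lookup_partial_deriv)
      show "\<forall>\<nu>\<in>Poly_Mapping.keys (partial_deriv v p). degree_in W \<nu> < k"
      proof
        fix \<nu> assume "\<nu> \<in> Poly_Mapping.keys (partial_deriv v p)"
        then have "degree_in W (\<nu> + Poly_Mapping.single v 1) < Suc k"
          using keys Suc.prems(1) by blast
        moreover have "degree_in W (\<nu> + Poly_Mapping.single v 1) = degree_in W \<nu> + 1"
          using v \<open>finite W\<close>
          by (simp add: degree_in_def lookup_add sum.distrib lookup_single when_def)
        ultimately show "degree_in W \<nu> < k" by simp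
      qed
      show "partial_deriv v p \<in> polys_over W"
        unfolding polys_over_def
      proof (safe)
        fix \<nu> u assume "\<nu> \<in> Poly_Mapping.keys (partial_deriv v p)" "u \<in> Poly_Mapping.keys \<nu>"
        then have "\<nu> + Poly_Mapping.single v 1 \<in> Poly_Mapping.keys p"
            "u \<in> Poly_Mapping.keys (\<nu> + Poly_Mapping.single v 1)"
          using keys by (auto simp: in_keys_iff lookup_add)
        then show "u \<in> W" using Suc.prems(2) by (auto simp: polys_over_def)
      qed
      show "eval_cpoly z (partial_deriv v p) = 0" if z: "\<And>v. v \<notin> W \<Longrightarrow> z v = 0" for z
      proof -
        have "(\<lambda>t. eval_cpoly (z(v := t)) p) = (\<lambda>t. 0)"
          using z v by (intro ext Suc.prems(3)) auto
        then have "((\<lambda>t. 0) has_field_derivative eval_cpoly (z(v := z v)) (partial_deriv v p)) (at (z v))"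
          using has_field_derivative_eval_cpoly[of z v p "z v"] by simp
        then show ?thesis using DERIV_unique[OF _ DERIV_const] by auto
      qed
    qed
    have "\<mu> = 0" if "\<mu> \<in> Poly_Mapping.keys p" for \<mu>
    proof (rule poly_mapping_eqI)
      fix v
      show "Poly_Mapping.lookup \<mu> v = Poly_Mapping.lookup 0 v"
      proof (rule ccontr)
        assume "Poly_Mapping.lookup \<mu> v \<noteq> Poly_Mapping.lookup 0 v"
        then have nz: "Poly_Mapping.lookup \<mu> v \<noteq> 0" by simp
        then have "v \<in> Poly_Mapping.keys \<mu>" by (simp add: in_keys_iff)
        then have "v \<in> W" using that Suc.prems(2) unfolding polys_over_def by blast
        define \<nu> where "\<nu> = \<mu> - Poly_Mapping.single v 1"
        have "\<nu> + Poly_Mapping.single v 1 = \<mu>"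
          unfolding \<nu>_def using nz
          by (intro poly_mapping_eqI) (auto simp: lookup_add lookup_minus lookup_single when_def)
        then have "Poly_Mapping.lookup (partial_deriv v p) \<nu> \<noteq> 0"
          using that by (simp add: lookup_partial_deriv in_keys_iff del: of_nat_Suc)
        then show False using deriv0[OF \<open>v \<in> W\<close>] by simp
      qed
    qed
    then have "Poly_Mapping.keys p \<subseteq> {0}" by auto
    then have "eval_cpoly (\<lambda>_. 0) p = Poly_Mapping.lookup p 0"
      by (simp add: eval_cpoly_superset[of "{0}"])
    then have "Poly_Mapping.lookup p 0 = 0" using Suc.prems(3)[of "\<lambda>_. 0"] by simp
    then have "Poly_Mapping.lookup p \<mu> = 0" for \<mu>
      using \<open>Poly_Mapping.keys p \<subseteq> {0}\<close> by (cases "\<mu> = 0") (auto simp flip: not_in_keys_iff_lookup_eq_zero)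
    then show "p = 0" by (intro poly_mapping_eqI) simp
  qed
qed

section \<open>Integration against Gaussian-like weights\<close>

lemma integrable_gaussian:
  fixes c :: real
  assumes "c > 0"
  shows "integrable lborel (\<lambda>x. exp (- c * x\<^sup>2))"
proof -
  \<comment> \<open>the standard deviation of the normal distribution with density proportional to \<open>exp(-c x\<^sup>2)\<close>\<close>
  define s where "s = 1 / sqrt (2 * c)"
  have s: "s > 0" "2 * s\<^sup>2 = 1 / c" using assms by (auto simp: s_def field_simps)
  have "(\<lambda>x. exp (- c * x\<^sup>2)) = (\<lambda>x. sqrt (2 * pi * s\<^sup>2) * normal_density 0 s x)"
    using s assms by (auto simp: normal_density_def fun_eq_iff)
  then show ?thesis
    using integrable_normal_density[OF s(1), of 0] by (metis integrable_mult_right)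
qed

lemma integral_of_derivative_eq_0:
  fixes F f :: "real \<Rightarrow> complex"
  assumes "\<And>t. (F has_vector_derivative f t) (at t)" "\<And>t. isCont f t" "integrable lborel f"
    and "(F \<longlongrightarrow> 0) at_top" "(F \<longlongrightarrow> 0) at_bot"
  shows "integral\<^sup>L lborel f = 0"
proof -
  have "(LBINT x=-\<infinity>..\<infinity>. f x) = 0 - 0"
    by (rule interval_integral_FTC_integrable[where F = F])
       (use assms in \<open>auto simp: ereal_tendsto_simps set_integrable_def\<close>)
  then show ?thesis by (simp add: interval_integral_to_infinity_eq interval_lebesgue_integral_def
        set_lebesgue_integral_def)
qed

lemma gaussian_bound_tendsto_0:
  fixes F :: "real \<Rightarrow> complex" and c C :: real
  assumes "c > 0" "\<And>t. norm (F t) \<le> C * exp (- c * t\<^sup>2)"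
  shows "(F \<longlongrightarrow> 0) at_top" "(F \<longlongrightarrow> 0) at_bot"
proof -
  have lim: "((\<lambda>t. C * exp (- c * t\<^sup>2)) \<longlongrightarrow> 0) at_top" "((\<lambda>t. C * exp (- c * t\<^sup>2)) \<longlongrightarrow> 0) at_bot"
    using assms(1) by real_asymp+
  have ev: "eventually (\<lambda>t. norm (F t) \<le> C * exp (- c * t\<^sup>2)) G" for G
    using assms(2) by (intro always_eventually allI)
  show "(F \<longlongrightarrow> 0) at_top" by (rule Lim_null_comparison[OF ev lim(1)])
  show "(F \<longlongrightarrow> 0) at_bot" by (rule Lim_null_comparison[OF ev lim(2)])
qed

lemma product_sigma_finite_lborel: "product_sigma_finite (\<lambda>_. lborel :: real measure)"
  by standard

lemma integrable_gaussian_product: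
  fixes c :: real
  assumes "finite I" "c > 0"
  shows "integrable (Pi\<^sub>M I (\<lambda>_. lborel)) (\<lambda>x. exp (- c * (\<Sum>i\<in>I. (x i)\<^sup>2)))"
proof -
  interpret product_sigma_finite "\<lambda>_. lborel :: real measure" by (rule product_sigma_finite_lborel)
  have "integrable (Pi\<^sub>M I (\<lambda>_. lborel)) (\<lambda>x. \<Prod>i\<in>I. exp (- c * (x i)\<^sup>2))"
    by (rule product_integrable_prod) (use assms integrable_gaussian in auto)
  then show ?thesis using assms(1) by (simp add: exp_sum sum_distrib_left flip: sum_negf)
qed

text \<open>
By Fubini one integrates first over the \<open>i\<close>-th coordinate, where the fundamental theorem of
calculus gives \<open>0\<close>. The pointwise Gaussian bounds make every slice integrable, not just almost
every one.
\<close>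

lemma integral_partial_derivative_eq_0:
  fixes F G :: "('i \<Rightarrow> real) \<Rightarrow> complex" and c :: real
  assumes I: "finite I" "i \<in> I" and "c > 0"
    and deriv: "\<And>x t. ((\<lambda>t. F (x(i := t))) has_vector_derivative G (x(i := t))) (at t)"
    and cont: "\<And>x t. isCont (\<lambda>t. G (x(i := t))) t"
    and meas: "G \<in> borel_measurable (Pi\<^sub>M I (\<lambda>_. lborel))"
    and bF: "\<And>x. norm (F x) \<le> B * exp (- c * (\<Sum>i\<in>I. (x i)\<^sup>2))"
    and bG: "\<And>x. norm (G x) \<le> C * exp (- c * (\<Sum>i\<in>I. (x i)\<^sup>2))"
  shows "integral\<^sup>L (Pi\<^sub>M I (\<lambda>_. lborel)) G = 0"
proof -
  interpret product_sigma_finite "\<lambda>_. lborel :: real measure" by (rule product_sigma_finite_lborel)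
  have slice: "norm (H (x(i := t))) \<le> \<bar>K\<bar> * exp (- c * t\<^sup>2)"
    if "\<And>x. norm (H x) \<le> K * exp (- c * (\<Sum>i\<in>I. (x i)\<^sup>2))"
    for H :: "('i \<Rightarrow> real) \<Rightarrow> complex" and K x t
  proof -
    have "t\<^sup>2 \<le> (\<Sum>j\<in>I. ((x(i := t)) j)\<^sup>2)"
      using member_le_sum[of i I "\<lambda>j. ((x(i := t)) j)\<^sup>2"] I by simp
    then have e: "exp (- c * (\<Sum>j\<in>I. ((x(i := t)) j)\<^sup>2)) \<le> exp (- c * t\<^sup>2)"
      using \<open>c > 0\<close> by simp
    have "norm (H (x(i := t))) \<le> K * exp (- c * (\<Sum>j\<in>I. ((x(i := t)) j)\<^sup>2))" by (rule that)
    also have "\<dots> \<le> \<bar>K\<bar> * exp (- c * (\<Sum>j\<in>I. ((x(i := t)) j)\<^sup>2))"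
      by (intro mult_right_mono) auto
    also have "\<dots> \<le> \<bar>K\<bar> * exp (- c * t\<^sup>2)" using e by (intro mult_left_mono) auto
    finally show ?thesis .
  qed
  have inner: "(\<integral>t. G (x(i := t)) \<partial>lborel) = 0" for x
  proof (rule integral_of_derivative_eq_0)
    show "((\<lambda>t. F (x(i := t))) has_vector_derivative G (x(i := t))) (at t)" for t by (rule deriv)
    show "isCont (\<lambda>t. G (x(i := t))) t" for t by (rule cont)
    show "integrable lborel (\<lambda>t. G (x(i := t)))"
    proof (rule Bochner_Integration.integrable_bound)
      show "integrable lborel (\<lambda>t. \<bar>C\<bar> * exp (- c * t\<^sup>2))"
        using integrable_gaussian[OF \<open>c > 0\<close>] by simp
      have "continuous_on UNIV (\<lambda>t. G (x(i := t)))"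
        using cont by (simp add: continuous_on_eq_continuous_at)
      then show "(\<lambda>t. G (x(i := t))) \<in> borel_measurable lborel"
        using borel_measurable_continuous_onI by simp
      show "AE t in lborel. norm (G (x(i := t))) \<le> norm (\<bar>C\<bar> * exp (- c * t\<^sup>2))"
        using slice[OF bG, of x] by (intro always_eventually allI) (simp add: abs_mult del: fun_upd_apply)
    qed
    show "((\<lambda>t. F (x(i := t))) \<longlongrightarrow> 0) at_top" "((\<lambda>t. F (x(i := t))) \<longlongrightarrow> 0) at_bot"
      by (rule gaussian_bound_tendsto_0[OF \<open>c > 0\<close> slice[OF bF, of x]])+
  qed
  have intG: "integrable (Pi\<^sub>M I (\<lambda>_. lborel)) G"
  proof (rule Bochner_Integration.integrable_bound)
    show "integrable (Pi\<^sub>M I (\<lambda>_. lborel)) (\<lambda>x. C * exp (- c * (\<Sum>i\<in>I. (x i)\<^sup>2)))"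
      using integrable_gaussian_product[OF I(1) \<open>c > 0\<close>] by simp
    show "AE x in Pi\<^sub>M I (\<lambda>_. lborel). norm (G x) \<le> norm (C * exp (- c * (\<Sum>i\<in>I. (x i)\<^sup>2)))"
      using bG by (intro always_eventually allI order_trans[OF bG]) auto
  qed (rule meas)
  have I_eq: "insert i (I - {i}) = I" using I by auto
  show ?thesis
    using product_integral_insert[of "I - {i}" i G, unfolded I_eq] I(1) intG
    by (simp add: inner del: fun_upd_apply)
qed

text \<open>
A point where \<open>f\<close> is positive has a neighbourhood, which contains a box, where \<open>f\<close> is positive;
the box has positive measure. Since \<open>f\<close> depends only on the coordinates in \<open>I\<close>, it does not matter
that the product measure lives on functions that are undefined outside \<open>I\<close>.
\<close>

lemma integral_eq_0_imp_eq_0: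
  fixes f :: "('i \<Rightarrow> real) \<Rightarrow> real"
  assumes I: "finite I" and cont: "continuous_on UNIV f" and nonneg: "\<And>x. f x \<ge> 0"
    and dep: "\<And>x y. (\<And>i. i \<in> I \<Longrightarrow> x i = y i) \<Longrightarrow> f x = f y"
    and int: "integrable (Pi\<^sub>M I (\<lambda>_. lborel)) f" and zero: "integral\<^sup>L (Pi\<^sub>M I (\<lambda>_. lborel)) f = 0"
  shows "f x = 0"
proof (rule ccontr)
  assume "f x \<noteq> 0"
  interpret product_sigma_finite "\<lambda>_. lborel :: real measure" by (rule product_sigma_finite_lborel)
  let ?M = "Pi\<^sub>M I (\<lambda>_. lborel :: real measure)"
  have "open (f -` (- {0}))"
    using cont by (intro open_vimage) (auto simp: continuous_on_eq_continuous_at)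
  then have "openin (product_topology (\<lambda>i. euclidean) UNIV) (f -` (- {0}))"
    by (simp add: euclidean_product_topology)
  from product_topology_open_contains_basis[OF this, of x] \<open>f x \<noteq> 0\<close>
  obtain U where U: "x \<in> (\<Pi>\<^sub>E i\<in>UNIV. U i)" "\<And>i. open (U i)" "(\<Pi>\<^sub>E i\<in>UNIV. U i) \<subseteq> f -` (- {0})"
    by auto
  have AE0: "AE y in ?M. f y = 0"
    using integral_nonneg_eq_0_iff_AE[OF int] nonneg zero by simp
  have "AE y in ?M. y \<notin> Pi\<^sub>E I U"
    using AE0
  proof eventually_elim
    case (elim y)
    show "y \<notin> Pi\<^sub>E I U"
    proof
      assume y: "y \<in> Pi\<^sub>E I U"
      define y' where "y' i = (if i \<in> I then y i else x i)" for i
      have "y' \<in> (\<Pi>\<^sub>E i\<in>UNIV. U i)" using y U(1) by (auto simp: y'_def PiE_def Pi_def)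
      then have "f y' \<noteq> 0" using U(3) by auto
      moreover have "f y' = f y" by (rule dep) (simp add: y'_def)
      ultimately show False using elim by simp
    qed
  qed
  moreover have sets: "Pi\<^sub>E I U \<in> sets ?M"
    using I U(2) by (intro sets_PiM_I_finite) auto
  ultimately have "emeasure ?M (Pi\<^sub>E I U) = 0"
    using AE_iff_measurable[OF sets, of "\<lambda>y. y \<notin> Pi\<^sub>E I U"] sets.sets_into_space[OF sets] by auto
  moreover have "emeasure ?M (Pi\<^sub>E I U) = (\<Prod>i\<in>I. emeasure lborel (U i))"
    using I U(2) by (intro emeasure_PiM) auto
  ultimately obtain i where "emeasure lborel (U i) = 0"
    using I by auto
  moreover have "x i \<in> U i" using U(1) by auto
  ultimately show False
    using open_not_negligible[of "U i"] U(2)[of i]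
    by (auto simp: negligible_iff_emeasure0 lmeasurable_iff_integrable)
qed

section \<open>Functions growing more slowly than every Gaussian\<close>

text \<open>
This class contains the polynomials and their conjugates, is closed under products, and its
members times any Gaussian are still bounded by a Gaussian. It spares all explicit growth estimates
for polynomials.
\<close>

definition subgaussian :: "'i set \<Rightarrow> (('i \<Rightarrow> real) \<Rightarrow> complex) \<Rightarrow> bool" where
  "subgaussian I f \<longleftrightarrow> (\<forall>e>0. \<exists>C. \<forall>x. norm (f x) \<le> C * exp (e * (\<Sum>i\<in>I. (x i)\<^sup>2)))"

lemma subgaussian_const: "subgaussian I (\<lambda>_. k)"
  unfolding subgaussian_def
proof safe
  fix e :: real assume "e > 0"
  have "norm k * 1 \<le> norm k * exp (e * (\<Sum>i\<in>I. (x i)\<^sup>2))" for x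
    by (rule mult_left_mono) (use \<open>e > 0\<close> in \<open>auto intro!: sum_nonneg mult_nonneg_nonneg\<close>)
  then show "\<exists>C. \<forall>x. norm k \<le> C * exp (e * (\<Sum>i\<in>I. (x i)\<^sup>2))" by auto
qed

lemma subgaussian_coordinate:
  assumes "finite I" "i \<in> I"
  shows "subgaussian I (\<lambda>x. complex_of_real (x i))"
  unfolding subgaussian_def
proof safe
  fix e :: real assume "e > 0"
  \<comment> \<open>so that \<open>|x| \<le> 1 + x\<^sup>2 \<le> C (1 + e x\<^sup>2) \<le> C exp(e x\<^sup>2)\<close>\<close>
  define C where "C = max 1 (1 / e)"
  have "\<bar>x i\<bar> \<le> C * exp (e * (\<Sum>i\<in>I. (x i)\<^sup>2))" for x
  proof -
    have "\<bar>x i\<bar> \<le> 1 + (x i)\<^sup>2"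
    proof -
      have "2 * \<bar>x i\<bar> \<le> 1 + (x i)\<^sup>2"
        using zero_le_power2[of "\<bar>x i\<bar> - 1"] by (simp add: power2_diff)
      then show ?thesis by linarith
    qed
    also have "\<dots> \<le> C + C * (e * (x i)\<^sup>2)"
    proof -
      have "1 \<le> C" "1 / e \<le> C" by (auto simp: C_def)
      then have "1 \<le> C * e" using \<open>e > 0\<close> by (simp add: field_simps)
      then have "1 * (x i)\<^sup>2 \<le> C * e * (x i)\<^sup>2" by (rule mult_right_mono) simp
      then show ?thesis using \<open>1 \<le> C\<close> by simp
    qed
    also have "\<dots> = C * (1 + e * (x i)\<^sup>2)" by (simp add: algebra_simps)
    also have "\<dots> \<le> C * exp (e * (x i)\<^sup>2)"
      by (intro mult_left_mono exp_ge_add_one_self) (simp add: C_def)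
    also have "\<dots> \<le> C * exp (e * (\<Sum>i\<in>I. (x i)\<^sup>2))"
      using member_le_sum[of i I "\<lambda>i. (x i)\<^sup>2"] assms \<open>e > 0\<close>
      by (intro mult_left_mono) (auto simp: C_def)
    finally show ?thesis .
  qed
  then show "\<exists>C. \<forall>x. norm (complex_of_real (x i)) \<le> C * exp (e * (\<Sum>i\<in>I. (x i)\<^sup>2))" by auto
qed

lemma subgaussian_add:
  assumes "subgaussian I f" "subgaussian I g"
  shows "subgaussian I (\<lambda>x. f x + g x)"
  unfolding subgaussian_def
proof safe
  fix e :: real assume "e > 0"
  then obtain C D where "\<And>x. norm (f x) \<le> C * exp (e * (\<Sum>i\<in>I. (x i)\<^sup>2))"
      "\<And>x. norm (g x) \<le> D * exp (e * (\<Sum>i\<in>I. (x i)\<^sup>2))"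
    using assms unfolding subgaussian_def by metis
  then have "norm (f x + g x) \<le> (C + D) * exp (e * (\<Sum>i\<in>I. (x i)\<^sup>2))" for x
    unfolding distrib_right using norm_triangle_mono by blast
  then show "\<exists>C. \<forall>x. norm (f x + g x) \<le> C * exp (e * (\<Sum>i\<in>I. (x i)\<^sup>2))" by blast
qed

lemma subgaussian_mult:
  assumes "subgaussian I f" "subgaussian I g"
  shows "subgaussian I (\<lambda>x. f x * g x)"
  unfolding subgaussian_def
proof safe
  fix e :: real assume "e > 0"
  then have "e / 2 > 0" by simp
  then obtain C D where f: "\<And>x. norm (f x) \<le> C * exp (e / 2 * (\<Sum>i\<in>I. (x i)\<^sup>2))"
      and g: "\<And>x. norm (g x) \<le> D * exp (e / 2 * (\<Sum>i\<in>I. (x i)\<^sup>2))"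
    using assms unfolding subgaussian_def by metis
  have "norm (f x * g x) \<le> (C * D) * exp (e * (\<Sum>i\<in>I. (x i)\<^sup>2))" for x
  proof -
    have "norm (f x * g x) \<le>
        (C * exp (e / 2 * (\<Sum>i\<in>I. (x i)\<^sup>2))) * (D * exp (e / 2 * (\<Sum>i\<in>I. (x i)\<^sup>2)))"
      unfolding norm_mult using f g by (intro mult_mono) (auto intro: order_trans[OF norm_ge_zero])
    also have "\<dots> = (C * D) * exp (e / 2 * (\<Sum>i\<in>I. (x i)\<^sup>2) + e / 2 * (\<Sum>i\<in>I. (x i)\<^sup>2))"
      by (simp only: exp_add mult_ac)
    also have "\<dots> = (C * D) * exp (e * (\<Sum>i\<in>I. (x i)\<^sup>2))" by (simp add: algebra_simps)
    finally show ?thesis .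
  qed
  then show "\<exists>C. \<forall>x. norm (f x * g x) \<le> C * exp (e * (\<Sum>i\<in>I. (x i)\<^sup>2))" by blast
qed

lemma subgaussian_cnj: "subgaussian I f \<Longrightarrow> subgaussian I (\<lambda>x. cnj (f x))"
  by (simp add: subgaussian_def)

lemma subgaussian_diff:
  "subgaussian I f \<Longrightarrow> subgaussian I g \<Longrightarrow> subgaussian I (\<lambda>x. f x - g x)"
  using subgaussian_add[of I f "\<lambda>x. (- 1) * g x"] subgaussian_mult[OF subgaussian_const, of I g "- 1"]
  by simp

lemma subgaussian_sum:
  "(\<And>k. k \<in> K \<Longrightarrow> subgaussian I (f k)) \<Longrightarrow> subgaussian I (\<lambda>x. \<Sum>k\<in>K. f k x)"
  by (induction K rule: infinite_finite_induct) (auto intro: subgaussian_const subgaussian_add)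

lemma subgaussian_power: "subgaussian I f \<Longrightarrow> subgaussian I (\<lambda>x. f x ^ n)"
  by (induction n) (auto intro: subgaussian_const subgaussian_mult)

lemma subgaussian_prod:
  "(\<And>k. k \<in> K \<Longrightarrow> subgaussian I (f k)) \<Longrightarrow> subgaussian I (\<lambda>x. \<Prod>k\<in>K. f k x)"
  by (induction K rule: infinite_finite_induct) (auto intro: subgaussian_const subgaussian_mult)

lemmas subgaussian_intros = subgaussian_const subgaussian_coordinate subgaussian_add
  subgaussian_mult subgaussian_cnj subgaussian_diff subgaussian_sum subgaussian_power subgaussian_prod

section \<open>A Hermitian form on polynomials\<close>

lemma of_real_norm_sq: "(complex_of_real (norm z))\<^sup>2 = z * cnj z"
  by (simp flip: complex_norm_square)

lemma borel_measurable_cnj [measurable (raw)]: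
  "f \<in> borel_measurable M \<Longrightarrow> (\<lambda>x. cnj (f x)) \<in> borel_measurable M"
  by (rule borel_measurable_continuous_on[where f = cnj]) (auto intro!: continuous_intros)

text \<open>
The weight is \<open>exp(-\<Sum>\<^sub>v |Q\<^sub>v|\<^sup>2)\<close> on \<open>\<complex>\<^sup>W\<close>. The set \<open>W\<close> of variables stays arbitrary: it has to
contain every variable of the polynomial to which positivity is applied, and this polynomial is not
always explicit.
\<close>

locale gaussian_pairing =
  fixes W :: "'v set" and Q :: "'v \<Rightarrow> 'v cpoly"
  assumes finite_W: "finite W"
    and coercive: "\<exists>c>0. \<exists>C. \<forall>z. (\<forall>v. v \<notin> W \<longrightarrow> z v = 0) \<longrightarrow>
          c * (\<Sum>v\<in>W. (norm (z v))\<^sup>2) \<le> C + (\<Sum>v\<in>W. (norm (eval_cpoly z (Q v)))\<^sup>2)"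
begin

abbreviation coords :: "('v \<times> bool) set" where "coords \<equiv> W \<times> UNIV"

abbreviation coord_measure :: "('v \<times> bool \<Rightarrow> real) measure" where
  "coord_measure \<equiv> Pi\<^sub>M coords (\<lambda>_. lborel)"

text \<open>
Real coordinates \<open>(v, False)\<close> and \<open>(v, True)\<close> are the real and the imaginary part of the
variable \<open>v\<close>. The value \<open>0\<close> outside \<open>W\<close> allows arbitrary polynomials to be evaluated.
\<close>

definition point :: "('v \<times> bool \<Rightarrow> real) \<Rightarrow> 'v \<Rightarrow> complex" where
  "point x v = (if v \<in> W then of_real (x (v, False)) + \<i> * of_real (x (v, True)) else 0)"

abbreviation ev :: "'v cpoly \<Rightarrow> ('v \<times> bool \<Rightarrow> real) \<Rightarrow> complex" where
  "ev a x \<equiv> eval_cpoly (point x) a"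

definition weight :: "('v \<times> bool \<Rightarrow> real) \<Rightarrow> complex" where
  "weight x = exp (- (\<Sum>v\<in>W. ev (Q v) x * cnj (ev (Q v) x)))"

definition pairing :: "'v cpoly \<Rightarrow> 'v cpoly \<Rightarrow> complex" where
  "pairing a b = (\<integral>x. ev a x * cnj (ev b x) * weight x \<partial>coord_measure)"

lemma finite_coords: "finite coords"
  using finite_W by simp

lemma norm_point_sq: "v \<in> W \<Longrightarrow> (norm (point x v))\<^sup>2 = (x (v, False))\<^sup>2 + (x (v, True))\<^sup>2"
  by (simp add: point_def cmod_power2)

lemma sum_coords: "(\<Sum>i\<in>coords. (x i)\<^sup>2) = (\<Sum>v\<in>W. (norm (point x v))\<^sup>2)"
proof -
  have "(\<Sum>i\<in>coords. (x i)\<^sup>2) = (\<Sum>v\<in>W. \<Sum>b\<in>UNIV. (x (v, b))\<^sup>2)"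
    by (simp add: sum.cartesian_product)
  then show ?thesis by (simp add: UNIV_bool norm_point_sq add.commute)
qed

lemma weight_eq: "weight x = of_real (exp (- (\<Sum>v\<in>W. (norm (ev (Q v) x))\<^sup>2)))"
  by (simp add: weight_def exp_of_real[symmetric] of_real_norm_sq)

lemma weight_bound: "\<exists>c>0. \<exists>C>0. \<forall>x. norm (weight x) \<le> C * exp (- c * (\<Sum>i\<in>coords. (x i)\<^sup>2))"
proof -
  obtain c C where "c > 0" and c: "\<And>z. (\<And>v. v \<notin> W \<Longrightarrow> z v = 0) \<Longrightarrow>
      c * (\<Sum>v\<in>W. (norm (z v))\<^sup>2) \<le> C + (\<Sum>v\<in>W. (norm (eval_cpoly z (Q v)))\<^sup>2)"
    using coercive by blast
  have "norm (weight x) \<le> exp C * exp (- c * (\<Sum>i\<in>coords. (x i)\<^sup>2))" for x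
  proof -
    have "norm (weight x) = exp (- (\<Sum>v\<in>W. (norm (ev (Q v) x))\<^sup>2))"
      by (simp add: weight_eq)
    also have "\<dots> \<le> exp (C - c * (\<Sum>i\<in>coords. (x i)\<^sup>2))"
      using c[of "point x"] by (simp add: sum_coords) (simp add: point_def)
    finally show ?thesis by (simp add: exp_diff exp_minus field_simps)
  qed
  then show ?thesis using \<open>c > 0\<close> by (intro exI[of _ c] conjI exI[of _ "exp C"]) auto
qed

lemma subgaussian_times_weight:
  assumes "subgaussian coords f"
  shows "\<exists>c>0. \<exists>C. \<forall>x. norm (f x * weight x) \<le> C * exp (- c * (\<Sum>i\<in>coords. (x i)\<^sup>2))"
proof -
  obtain c C where "c > 0" "C > 0"
      and w: "\<And>x. norm (weight x) \<le> C * exp (- c * (\<Sum>i\<in>coords. (x i)\<^sup>2))"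
    using weight_bound by blast
  obtain D where f: "\<And>x. norm (f x) \<le> D * exp (c / 2 * (\<Sum>i\<in>coords. (x i)\<^sup>2))"
    using assms \<open>c > 0\<close> unfolding subgaussian_def by (meson half_gt_zero)
  have "norm (f x * weight x) \<le> (D * C) * exp (- (c / 2) * (\<Sum>i\<in>coords. (x i)\<^sup>2))" for x
  proof -
    have "norm (f x * weight x) \<le>
        (D * exp (c / 2 * (\<Sum>i\<in>coords. (x i)\<^sup>2))) * (C * exp (- c * (\<Sum>i\<in>coords. (x i)\<^sup>2)))"
      unfolding norm_mult using f w by (intro mult_mono) (auto intro: order_trans[OF norm_ge_zero])
    also have "\<dots> = (D * C) * exp (c / 2 * (\<Sum>i\<in>coords. (x i)\<^sup>2) + - c * (\<Sum>i\<in>coords. (x i)\<^sup>2))"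
      by (simp only: exp_add mult_ac)
    also have "c / 2 * (\<Sum>i\<in>coords. (x i)\<^sup>2) + - c * (\<Sum>i\<in>coords. (x i)\<^sup>2) =
        - (c / 2) * (\<Sum>i\<in>coords. (x i)\<^sup>2)" by (simp add: field_simps)
    finally show ?thesis .
  qed
  then show ?thesis using \<open>c > 0\<close> by (intro exI[of _ "c / 2"]) auto
qed

lemma subgaussian_ev: "subgaussian coords (ev a)"
proof (induction a rule: cpoly_induct)
  case (monomial \<mu> c)
  have "subgaussian coords (\<lambda>x. point x v)" for v
    by (cases "v \<in> W") (auto simp: point_def finite_W intro!: subgaussian_intros)
  then show ?case by (auto simp: eval_monomial_def intro!: subgaussian_intros)
qed (auto intro!: subgaussian_intros)

lemma measurable_ev [measurable]: "ev a \<in> borel_measurable coord_measure"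
proof (induction a rule: cpoly_induct)
  case (monomial \<mu> c)
  have [measurable]: "(\<lambda>x. point x v) \<in> borel_measurable coord_measure" for v
  proof (cases "v \<in> W")
    case True
    then have [measurable]: "(\<lambda>x. x (v, b)) \<in> borel_measurable coord_measure" for b
      using measurable_component_singleton[of "(v, b)" coords "\<lambda>_. lborel :: real measure"] by simp
    show ?thesis using True by (simp add: point_def)
  qed (simp add: point_def)
  show ?case by (simp add: eval_monomial_def)
qed auto

lemma measurable_weight [measurable]: "weight \<in> borel_measurable coord_measure"
  unfolding weight_def[abs_def] by measurable

lemma integrable_times_weight:
  assumes "subgaussian coords f" "f \<in> borel_measurable coord_measure"
  shows "integrable coord_measure (\<lambda>x. f x * weight x)"
proof -
  obtain c C where "c > 0" and
      b: "\<And>x. norm (f x * weight x) \<le> C * exp (- c * (\<Sum>i\<in>coords. (x i)\<^sup>2))"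
    using subgaussian_times_weight[OF assms(1)] by blast
  show ?thesis
  proof (rule Bochner_Integration.integrable_bound)
    show "integrable coord_measure (\<lambda>x. C * exp (- c * (\<Sum>i\<in>coords. (x i)\<^sup>2)))"
      using integrable_gaussian_product[OF finite_coords \<open>c > 0\<close>] by simp
    show "AE x in coord_measure. norm (f x * weight x) \<le> norm (C * exp (- c * (\<Sum>i\<in>coords. (x i)\<^sup>2)))"
      using b by (intro always_eventually allI order_trans[OF b]) auto
    show "(\<lambda>x. f x * weight x) \<in> borel_measurable coord_measure" using assms(2) by measurable
  qed
qed

lemma integrable_pairing: "integrable coord_measure (\<lambda>x. ev a x * cnj (ev b x) * weight x)"
  by (rule integrable_times_weight) (auto intro!: subgaussian_intros subgaussian_ev)

lemma pairing_add_left: "pairing (a + a') b = pairing a b + pairing a' b"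
  unfolding pairing_def eval_cpoly_add distrib_right
  by (intro Bochner_Integration.integral_add integrable_pairing)

lemma pairing_commute: "pairing b a = cnj (pairing a b)"
proof -
  have "cnj (pairing a b) = (\<integral>x. cnj (ev a x * cnj (ev b x) * weight x) \<partial>coord_measure)"
    unfolding pairing_def by (rule Bochner_Integration.integral_cnj[symmetric])
  also have "\<dots> = pairing b a"
    unfolding pairing_def by (rule Bochner_Integration.integral_cong) (simp_all add: weight_eq mult_ac)
  finally show ?thesis by simp
qed

lemma pairing_add_right: "pairing a (b + b') = pairing a b + pairing a b'"
  using pairing_add_left[of b b' a] pairing_commute by (metis complex_cnj_add)

lemma pairing_0_left [simp]: "pairing 0 b = 0"
  by (simp add: pairing_def)

lemma pairing_0_right [simp]: "pairing a 0 = 0"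
  by (simp add: pairing_def)

lemma pairing_sum_left: "pairing (\<Sum>k\<in>K. f k) b = (\<Sum>k\<in>K. pairing (f k) b)"
  by (induction K rule: infinite_finite_induct) (auto simp: pairing_add_left)

lemma pairing_sum_right: "pairing a (\<Sum>k\<in>K. f k) = (\<Sum>k\<in>K. pairing a (f k))"
  by (induction K rule: infinite_finite_induct) (auto simp: pairing_add_right)

lemma pairing_diff_right: "pairing a (b - b') = pairing a b - pairing a b'"
  using pairing_add_right[of a "b - b'" b'] by simp

lemma pairing_of_nat_right: "pairing a (of_nat k * b) = of_nat k * pairing a b"
  by (induction k) (auto simp: distrib_right pairing_add_right)

lemma pairing_self: "pairing a a = of_real (\<integral>x. (norm (ev a x))\<^sup>2 *
    exp (- (\<Sum>v\<in>W. (norm (ev (Q v) x))\<^sup>2)) \<partial>coord_measure)"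
  unfolding pairing_def integral_complex_of_real[symmetric]
  by (rule Bochner_Integration.integral_cong) (auto simp: weight_eq of_real_norm_sq)

lemma Re_pairing_self_nonneg: "Re (pairing a a) \<ge> 0"
  unfolding pairing_self by (auto intro: integral_nonneg_AE)

lemma continuous_ev: "continuous_on UNIV (ev a)"
proof (induction a rule: cpoly_induct)
  case (monomial \<mu> c)
  have "continuous_on UNIV (\<lambda>x. point x v)" for v
    unfolding point_def
    by (cases "v \<in> W")
       (simp_all add: continuous_on_add continuous_on_mult continuous_on_of_real)
  then show ?case by (simp add: eval_monomial_def continuous_on_mult continuous_on_prod continuous_on_power)
qed (simp_all add: continuous_on_add)

lemma pairing_self_eq_0_imp:
  assumes "pairing a a = 0" "a \<in> polys_over W"
  shows "a = 0"
proof (rule eval_cpoly_zero_imp_zero[OF finite_W assms(2)])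
  fix z :: "'v \<Rightarrow> complex" assume z: "\<And>v. v \<notin> W \<Longrightarrow> z v = 0"
  define f where "f x = (norm (ev a x))\<^sup>2 * exp (- (\<Sum>v\<in>W. (norm (ev (Q v) x))\<^sup>2))" for x
  have "f x = 0" for x
  proof (rule integral_eq_0_imp_eq_0[where f = f, OF finite_coords])
    show "continuous_on UNIV f" unfolding f_def by (intro continuous_intros continuous_ev)
    show "f x \<ge> 0" for x by (simp add: f_def)
    show "f x = f y" if "\<And>i. i \<in> coords \<Longrightarrow> x i = y i" for x y
    proof -
      have "point x = point y" using that by (auto simp: point_def fun_eq_iff)
      then show ?thesis by (simp add: f_def)
    qed
    have "(\<lambda>x. complex_of_real (f x)) = (\<lambda>x. ev a x * cnj (ev a x) * weight x)"
      by (auto simp: f_def weight_eq of_real_norm_sq)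
    then have "integrable coord_measure (\<lambda>x. complex_of_real (f x))"
      using integrable_pairing[of a a] by simp
    then show "integrable coord_measure f" using integrable_Re by fastforce
    show "integral\<^sup>L coord_measure f = 0"
      using assms(1) unfolding pairing_self f_def by simp
  qed
  moreover define x where "x i = (if snd i then Im (z (fst i)) else Re (z (fst i)))" for i
  moreover have "point x = z"
    using z by (auto simp: point_def x_def fun_eq_iff complex_eq_iff)
  ultimately have "f x = 0" "ev a x = eval_cpoly z a" by auto
  then show "eval_cpoly z a = 0" by (simp add: f_def)
qed

section \<open>Integration by parts\<close>

lemma point_update:
  assumes "u \<in> W"
  defines "\<epsilon> \<equiv> \<lambda>b. if b then \<i> else 1"
  shows "point (x((u, b) := t)) = (point x)(u := point (x((u, b) := 0)) u + \<epsilon> b * of_real t)"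
  using assms(1) by (auto simp: point_def fun_eq_iff \<epsilon>_def)

lemma has_vector_derivative_ev:
  fixes x :: "'v \<times> bool \<Rightarrow> real"
  assumes u: "u \<in> W"
  shows "((\<lambda>t. ev a (x((u, b) := t))) has_vector_derivative
      (if b then \<i> else 1) * ev (partial_deriv u a) (x((u, b) := t))) (at t)"
proof -
  let ?\<epsilon> = "if b then \<i> else 1 :: complex"
  define p where "p = point (x((u, b) := 0)) u"
  have pt: "point (x((u, b) := t)) = (point x)(u := p + ?\<epsilon> * of_real t)" for t
    unfolding p_def by (rule point_update[OF u])
  have "((\<lambda>t. p + ?\<epsilon> * of_real t) has_vector_derivative ?\<epsilon>) (at t)"
    by (auto intro!: derivative_eq_intros)
  from field_vector_diff_chain_at[OF this has_field_derivative_eval_cpoly[of "point x" u a]]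
  show ?thesis unfolding pt o_def .
qed

lemma has_vector_derivative_weight:
  fixes x :: "'v \<times> bool \<Rightarrow> real"
  assumes u: "u \<in> W"
  defines "\<epsilon> \<equiv> \<lambda>b. if b then \<i> else 1"
  shows "((\<lambda>t. weight (x((u, b) := t))) has_vector_derivative
     - (\<Sum>v\<in>W. \<epsilon> b * ev (partial_deriv u (Q v)) (x((u, b) := t)) * cnj (ev (Q v) (x((u, b) := t))) +
             ev (Q v) (x((u, b) := t)) * cnj (\<epsilon> b * ev (partial_deriv u (Q v)) (x((u, b) := t)))) *
     weight (x((u, b) := t))) (at t)"
proof -
  define g where "g t = - (\<Sum>v\<in>W. ev (Q v) (x((u, b) := t)) * cnj (ev (Q v) (x((u, b) := t))))" for t
  define D where "D t = - (\<Sum>v\<in>W. ev (Q v) (x((u, b) := t)) * cnj (\<epsilon> b * ev (partial_deriv u (Q v)) (x((u, b) := t)))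
       + \<epsilon> b * ev (partial_deriv u (Q v)) (x((u, b) := t)) * cnj (ev (Q v) (x((u, b) := t))))" for t
  have "(g has_vector_derivative D t) (at t)"
    unfolding g_def D_def \<epsilon>_def
    by (intro has_vector_derivative_minus has_vector_derivative_sum has_vector_derivative_mult
          has_vector_derivative_cnj has_vector_derivative_ev u)
  from field_vector_diff_chain_at[OF this DERIV_exp]
  have "((\<lambda>t. exp (g t)) has_vector_derivative D t * exp (g t)) (at t)" by (simp add: o_def)
  then show ?thesis
    by (simp only: g_def D_def weight_def add.commute)
qed

text \<open>
Formally \<open>\<partial>\<^sub>u (a cnj(b) exp(-\<Sum>\<^sub>v Q\<^sub>v cnj(Q\<^sub>v)))\<close> has integral \<open>0\<close>, and the Wirtinger derivative
\<open>\<partial>\<^sub>u\<close> does not act on conjugates of polynomials. The real directions are combined to get it: with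
\<open>T\<close> collecting the holomorphic and \<open>T'\<close> the antiholomorphic part, the derivative in the
direction \<open>\<epsilon>\<close> is \<open>\<epsilon> T + cnj(\<epsilon>) T'\<close>, and \<open>\<epsilon> = 1\<close>, \<open>\<epsilon> = \<i>\<close> together isolate \<open>T\<close>.
\<close>

lemma integration_by_parts:
  assumes u: "u \<in> W"
  shows "pairing (partial_deriv u a) b = (\<Sum>v\<in>W. pairing (a * partial_deriv u (Q v)) (Q v * b))"
proof -
  define T where "T x = ev (partial_deriv u a) x * cnj (ev b x) -
      (\<Sum>v\<in>W. ev (a * partial_deriv u (Q v)) x * cnj (ev (Q v * b) x))" for x
  define T' where "T' x = ev a x * cnj (ev (partial_deriv u b) x) -
      (\<Sum>v\<in>W. ev (a * Q v) x * cnj (ev (partial_deriv u (Q v) * b) x))" for x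
  have [measurable]: "T \<in> borel_measurable coord_measure" "T' \<in> borel_measurable coord_measure"
    unfolding T_def[abs_def] T'_def[abs_def] by measurable
  have sub: "subgaussian coords T" "subgaussian coords T'"
    unfolding T_def[abs_def] T'_def[abs_def] by (intro subgaussian_intros subgaussian_ev)+
  have zero: "(\<integral>x. (\<epsilon> * T x + cnj \<epsilon> * T' x) * weight x \<partial>coord_measure) = 0"
    if \<epsilon>: "\<epsilon> = (if d then \<i> else 1)" for \<epsilon> d
  proof -
    define F where "F x = (ev a x * cnj (ev b x)) * weight x" for x
    define H where "H x = \<epsilon> * T x + cnj \<epsilon> * T' x" for x
    have "subgaussian coords (\<lambda>x. ev a x * cnj (ev b x))" "subgaussian coords H"
      unfolding H_def[abs_def] by (intro subgaussian_intros subgaussian_ev sub)+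
    from this[THEN subgaussian_times_weight] obtain c c' B C where c: "c > 0" "c' > 0"
      and F: "\<And>x. norm (F x) \<le> B * exp (- c * (\<Sum>i\<in>coords. (x i)\<^sup>2))"
      and H: "\<And>x. norm (H x * weight x) \<le> C * exp (- c' * (\<Sum>i\<in>coords. (x i)\<^sup>2))"
      unfolding F_def by blast
    have weaken: "norm z \<le> \<bar>K\<bar> * exp (- min c c' * (\<Sum>i\<in>coords. (x i)\<^sup>2))"
      if "norm z \<le> K * exp (- k * (\<Sum>i\<in>coords. (x i)\<^sup>2))" "k \<ge> min c c'"
      for z :: complex and k K and x :: "'v \<times> bool \<Rightarrow> real"
    proof -
      have "norm z \<le> \<bar>K\<bar> * exp (- k * (\<Sum>i\<in>coords. (x i)\<^sup>2))"
        by (rule order_trans[OF that(1)]) (intro mult_right_mono, auto)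
      also have "\<dots> \<le> \<bar>K\<bar> * exp (- min c c' * (\<Sum>i\<in>coords. (x i)\<^sup>2))"
        using mult_right_mono[OF that(2), of "\<Sum>i\<in>coords. (x i)\<^sup>2"]
        by (intro mult_left_mono) (auto simp: sum_nonneg)
      finally show ?thesis .
    qed
    have "integral\<^sup>L coord_measure (\<lambda>x. H x * weight x) = 0"
    proof (rule integral_partial_derivative_eq_0[OF finite_coords, where i = "(u, d)" and F = F
          and c = "min c c'" and B = "\<bar>B\<bar>" and C = "\<bar>C\<bar>"])
      show "(u, d) \<in> coords" using u by simp
      show "min c c' > 0" using c by simp
      show "norm (F x) \<le> \<bar>B\<bar> * exp (- min c c' * (\<Sum>i\<in>coords. (x i)\<^sup>2))" for x
        by (rule weaken[OF F]) simp
      show "norm (H x * weight x) \<le> \<bar>C\<bar> * exp (- min c c' * (\<Sum>i\<in>coords. (x i)\<^sup>2))" for x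
        by (rule weaken[OF H]) simp
      show "(\<lambda>x. H x * weight x) \<in> borel_measurable coord_measure"
        unfolding H_def by measurable
      fix x t
      have H_eq: "H y * weight y = (ev a y * cnj (ev b y)) *
          (- (\<Sum>v\<in>W. \<epsilon> * ev (partial_deriv u (Q v)) y * cnj (ev (Q v) y) +
             ev (Q v) y * cnj (\<epsilon> * ev (partial_deriv u (Q v)) y)) * weight y) +
          (ev a y * cnj (\<epsilon> * ev (partial_deriv u b) y) + \<epsilon> * ev (partial_deriv u a) y * cnj (ev b y)) *
            weight y" for y
        by (simp add: H_def T_def T'_def algebra_simps sum.distrib sum_distrib_left)
      show "((\<lambda>t. F (x((u, d) := t))) has_vector_derivative
          H (x((u, d) := t)) * weight (x((u, d) := t))) (at t)"
        unfolding F_def H_eq unfolding \<epsilon>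
        by (intro has_vector_derivative_mult has_vector_derivative_cnj has_vector_derivative_ev
              has_vector_derivative_weight u)
      have ev_cont: "isCont (\<lambda>t. ev p (x((u, d) := t))) t" for p
        using has_vector_derivative_ev[OF u] by (rule has_vector_derivative_continuous)
      have weight_cont: "isCont (\<lambda>t. weight (x((u, d) := t))) t"
        using has_vector_derivative_weight[OF u] by (rule has_vector_derivative_continuous)
      show "isCont (\<lambda>t. H (x((u, d) := t)) * weight (x((u, d) := t))) t"
        unfolding H_def T_def T'_def
        by (intro isCont_mult isCont_add isCont_diff continuous_sum isCont_cnj ev_cont weight_cont
              continuous_const)
    qed
    then show ?thesis by (simp add: H_def)
  qed
  have intT: "integrable coord_measure (\<lambda>x. T x * weight x)"
      "integrable coord_measure (\<lambda>x. T' x * weight x)"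
    by (intro integrable_times_weight sub; measurable)+
  define s where "s = (\<integral>x. T x * weight x \<partial>coord_measure)"
  define s' where "s' = (\<integral>x. T' x * weight x \<partial>coord_measure)"
  have "\<epsilon> * s + cnj \<epsilon> * s' = 0" if "\<epsilon> = (if d then \<i> else 1)" for \<epsilon> d
    using zero[OF that] intT by (simp add: distrib_right mult.assoc s_def s'_def)
  from this[of 1 False] this[of \<i> True] have "s + s' = 0" "\<i> * (s - s') = 0"
    by (simp_all add: algebra_simps)
  then have "s = 0" by simp
  moreover have "s = pairing (partial_deriv u a) b - (\<Sum>v\<in>W. pairing (a * partial_deriv u (Q v)) (Q v * b))"
    unfolding s_def T_def pairing_def left_diff_distrib sum_distrib_right
    by (subst Bochner_Integration.integral_diff)
       (auto intro!: integrable_pairing Bochner_Integration.integrable_sum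
          simp: Bochner_Integration.integral_sum[OF integrable_pairing] simp del: eval_cpoly_mult)
  ultimately show ?thesis by simp
qed

end

section \<open>Derivations and determinants\<close>

locale derivation =
  fixes \<delta> :: "'a::comm_ring_1 \<Rightarrow> 'a"
  assumes add: "\<delta> (a + b) = \<delta> a + \<delta> b"
    and mult: "\<delta> (a * b) = \<delta> a * b + a * \<delta> b"
begin

lemma zero [simp]: "\<delta> 0 = 0"
  using add[of 0 0] by simp

lemma one [simp]: "\<delta> 1 = 0"
  using mult[of 1 1] by simp

lemma uminus: "\<delta> (- a) = - \<delta> a"
  using add[of a "- a"] by (simp add: eq_neg_iff_add_eq_0 add.commute)

lemma diff: "\<delta> (a - b) = \<delta> a - \<delta> b"
  using add[of a "- b"] uminus[of b] by simp

lemma sum: "\<delta> (\<Sum>k\<in>K. f k) = (\<Sum>k\<in>K. \<delta> (f k))"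
  by (induction K rule: infinite_finite_induct) (auto simp: add)

lemma of_nat [simp]: "\<delta> (of_nat k) = 0"
  by (induction k) (auto simp: add)

lemma of_int [simp]: "\<delta> (of_int k) = 0"
  by (cases k) (auto simp: uminus diff)

lemma prod:
  "finite K \<Longrightarrow> \<delta> (\<Prod>k\<in>K. f k) = (\<Sum>k\<in>K. \<delta> (f k) * (\<Prod>l\<in>K - {k}. f l))"
proof (induction K rule: finite_induct)
  case (insert m K)
  have "(\<Sum>k\<in>K. \<delta> (f k) * (\<Prod>l\<in>insert m K - {k}. f l)) =
      (\<Sum>k\<in>K. f m * (\<delta> (f k) * (\<Prod>l\<in>K - {k}. f l)))"
  proof (rule sum.cong[OF refl])
    fix k assume "k \<in> K"
    then have "insert m K - {k} = insert m (K - {k})" using insert.hyps by auto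
    then show "\<delta> (f k) * (\<Prod>l\<in>insert m K - {k}. f l) = f m * (\<delta> (f k) * (\<Prod>l\<in>K - {k}. f l))"
      using insert.hyps by (simp add: mult_ac)
  qed
  then show ?case
    using insert by (simp add: mult sum_distrib_left)
qed simp

lemma power_eq_0: "\<delta> a = 0 \<Longrightarrow> \<delta> (a ^ k) = 0"
  by (induction k) (auto simp: mult)

text \<open>
Jacobi's formula. By the product rule the derivative of the determinant is the sum of the
determinants of the matrices \<open>B k\<close> in which only the \<open>k\<close>-th row is differentiated; these are
expanded along that row.
\<close>

lemma det:
  assumes A: "A \<in> carrier_mat n n"
  shows "\<delta> (det A) = (\<Sum>k<n. \<Sum>j<n. \<delta> (A $$ (k, j)) * cofactor A k j)"
proof -
  define B where "B k = mat n n (\<lambda>(i, j). if i = k then \<delta> (A $$ (i, j)) else A $$ (i, j))" for k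
  have B: "B k \<in> carrier_mat n n" for k by (simp add: B_def)
  have detB: "det (B k) = (\<Sum>j<n. \<delta> (A $$ (k, j)) * cofactor A k j)" if "k < n" for k
  proof -
    have "mat_delete (B k) k j = mat_delete A k j" if "j < n" for j
      using A \<open>k < n\<close> that by (intro eq_matI) (auto simp: mat_delete_def B_def)
    then show ?thesis
      unfolding laplace_expansion_row[OF B that]
      using \<open>k < n\<close> by (intro sum.cong) (auto simp: cofactor_def B_def)
  qed
  have "\<delta> (det A) = (\<Sum>p | p permutes {0..<n}. \<Sum>k<n.
      signof p * (\<delta> (A $$ (k, p k)) * (\<Prod>i\<in>{0..<n} - {k}. A $$ (i, p i))))"
    by (simp add: det_def'[OF A] sum mult prod sum_distrib_left atLeast0LessThan)
  also have "\<dots> = (\<Sum>p | p permutes {0..<n}. \<Sum>k<n. signof p * (\<Prod>i = 0..<n. B k $$ (i, p i)))"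
  proof (intro sum.cong refl arg_cong2[where f = "(*)"])
    fix p k assume p: "p \<in> {p. p permutes {0..<n}}" and k: "k \<in> {..<n}"
    have pi: "p i < n" if "i < n" for i
      using p that permutes_in_image[of p "{0..<n}" i] by auto
    have "(\<Prod>i = 0..<n. B k $$ (i, p i)) =
        B k $$ (k, p k) * (\<Prod>i\<in>{0..<n} - {k}. B k $$ (i, p i))"
      using k by (intro prod.remove) auto
    also have "(\<Prod>i\<in>{0..<n} - {k}. B k $$ (i, p i)) = (\<Prod>i\<in>{0..<n} - {k}. A $$ (i, p i))"
      using pi by (intro prod.cong) (auto simp: B_def)
    also have "B k $$ (k, p k) = \<delta> (A $$ (k, p k))" using k pi by (simp add: B_def)
    finally show "\<delta> (A $$ (k, p k)) * (\<Prod>i\<in>{0..<n} - {k}. A $$ (i, p i)) =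
        (\<Prod>i = 0..<n. B k $$ (i, p i))" ..
  qed
  also have "\<dots> = (\<Sum>k<n. det (B k))"
    by (subst sum.swap) (simp add: det_def'[OF B])
  finally show ?thesis by (simp add: detB)
qed

lemma cofactor_eq_0:
  assumes A: "A \<in> carrier_mat n n" and zero: "\<And>k l. k < n \<Longrightarrow> l < n \<Longrightarrow> \<delta> (A $$ (k, l)) = 0"
    and "i < n" "j < n"
  shows "\<delta> (cofactor A i j) = 0"
proof -
  have carrier: "mat_delete A i j \<in> carrier_mat (n - 1) (n - 1)"
    using A by (rule mat_delete_carrier)
  have "\<delta> (mat_delete A i j $$ (k, l)) = 0" if "k < n - 1" "l < n - 1" for k l
    using A that by (auto simp: mat_delete_def intro!: zero)
  then have "\<delta> (det (mat_delete A i j)) = 0"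
    by (simp add: det[OF carrier])
  then show ?thesis by (simp add: cofactor_def mult power_eq_0 uminus)
qed

end

lemma sum_row_cofactor:
  fixes A :: "'a::comm_ring_1 mat"
  assumes A: "A \<in> carrier_mat n n" and "k < n" "i < n"
  shows "(\<Sum>j<n. A $$ (k, j) * cofactor A i j) = (if k = i then det A else 0)"
proof -
  have "(A * adj_mat A) $$ (k, i) = (\<Sum>j<n. A $$ (k, j) * cofactor A i j)"
    using A assms by (simp add: adj_mat_def scalar_prod_def atLeast0LessThan)
  moreover have "(A * adj_mat A) $$ (k, i) = (if k = i then det A else 0)"
    using assms by (simp add: adj_mat(2)[OF A])
  ultimately show ?thesis by simp
qed

lemma sum_column_cofactor:
  fixes A :: "'a::comm_ring_1 mat"
  assumes A: "A \<in> carrier_mat n n" and "l < n" "j < n"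
  shows "(\<Sum>k<n. cofactor A k l * A $$ (k, j)) = (if l = j then det A else 0)"
proof -
  have "(adj_mat A * A) $$ (l, j) = (\<Sum>k<n. cofactor A k l * A $$ (k, j))"
    using A assms by (simp add: adj_mat_def scalar_prod_def atLeast0LessThan)
  moreover have "(adj_mat A * A) $$ (l, j) = (if l = j then det A else 0)"
    using assms by (simp add: adj_mat(3)[OF A])
  ultimately show ?thesis by simp
qed

lemma sum_reverse_3:
  "(\<Sum>l\<in>A. \<Sum>k\<in>B. \<Sum>j\<in>C. f l k j) = (\<Sum>j\<in>C. \<Sum>k\<in>B. \<Sum>l\<in>A. f l k j)"
proof -
  have "(\<Sum>l\<in>A. \<Sum>k\<in>B. \<Sum>j\<in>C. f l k j) = (\<Sum>l\<in>A. \<Sum>j\<in>C. \<Sum>k\<in>B. f l k j)"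
    by (intro sum.cong refl sum.swap)
  also have "\<dots> = (\<Sum>j\<in>C. \<Sum>l\<in>A. \<Sum>k\<in>B. f l k j)" by (rule sum.swap)
  also have "\<dots> = (\<Sum>j\<in>C. \<Sum>k\<in>B. \<Sum>l\<in>A. f l k j)"
    by (intro sum.cong refl sum.swap)
  finally show ?thesis .
qed

text \<open>
With \<open>c\<close> for the cofactors and \<open>J\<close> for the determinant of the Jacobian matrix, apply \<open>\<delta>\<^sub>l\<close> to
\<open>\<Sum>\<^sub>j \<delta>\<^sub>j(p\<^sub>k) c\<^sub>i\<^sub>j = [k = i] J\<close>, multiply by \<open>c\<^sub>k\<^sub>l\<close> and sum over \<open>k\<close> and \<open>l\<close>. The second
derivatives contribute \<open>\<Sum>\<^sub>j c\<^sub>i\<^sub>j \<delta>\<^sub>j(J)\<close> by Jacobi's formula, which is also the right hand side.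
What remains is \<open>J \<Sum>\<^sub>l \<delta>\<^sub>l(c\<^sub>i\<^sub>l) = 0\<close>.
\<close>

lemma piola_identity:
  fixes \<delta> :: "nat \<Rightarrow> 'a::idom \<Rightarrow> 'a" and p :: "nat \<Rightarrow> 'a" and n :: nat
  assumes der: "\<And>j. derivation (\<delta> j)" and comm: "\<And>i j a. \<delta> i (\<delta> j a) = \<delta> j (\<delta> i a)"
  defines "M \<equiv> mat n n (\<lambda>(k, j). \<delta> j (p k))"
  assumes det: "det M \<noteq> 0" and i: "i < n"
  shows "(\<Sum>j<n. \<delta> j (cofactor M i j)) = 0"
proof -
  have M: "M \<in> carrier_mat n n" by (simp add: M_def)
  have Mkj: "M $$ (k, j) = \<delta> j (p k)" if "k < n" "j < n" for k j using that by (simp add: M_def)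
  define J where "J = det M"
  define c where "c = cofactor M"
  have row: "(\<Sum>j<n. \<delta> j (p k) * c i j) = (if k = i then J else 0)" if "k < n" for k
    using sum_row_cofactor[OF M that i] that by (simp add: Mkj J_def c_def)
  have col: "(\<Sum>k<n. c k l * \<delta> j (p k)) = (if l = j then J else 0)" if "l < n" "j < n" for l j
    using sum_column_cofactor[OF M that] that by (simp add: Mkj J_def c_def)
  have jacobi: "\<delta> j J = (\<Sum>k<n. \<Sum>l<n. \<delta> j (\<delta> l (p k)) * c k l)" for j
    unfolding J_def derivation.det[OF der M] c_def by (intro sum.cong refl) (simp add: Mkj)
  have diff_row: "(\<Sum>j<n. \<delta> j (\<delta> l (p k)) * c i j) + (\<Sum>j<n. \<delta> j (p k) * \<delta> l (c i j)) =
      (if k = i then \<delta> l J else 0)" if "k < n" for k l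
  proof -
    have "\<delta> l (\<Sum>j<n. \<delta> j (p k) * c i j) =
        (\<Sum>j<n. \<delta> j (\<delta> l (p k)) * c i j) + (\<Sum>j<n. \<delta> j (p k) * \<delta> l (c i j))"
      by (simp add: derivation.sum[OF der] derivation.mult[OF der] sum.distrib comm[of l])
    then show ?thesis using row[OF that] by (auto simp: derivation.zero[OF der])
  qed
  have "(\<Sum>l<n. \<Sum>k<n. c k l * ((\<Sum>j<n. \<delta> j (\<delta> l (p k)) * c i j) + (\<Sum>j<n. \<delta> j (p k) * \<delta> l (c i j)))) =
      (\<Sum>l<n. \<Sum>k<n. c k l * (if k = i then \<delta> l J else 0))"
    by (intro sum.cong refl) (simp add: diff_row)
  also have "\<dots> = (\<Sum>l<n. c i l * \<delta> l J)"
    using i by (simp add: if_distrib sum.delta cong: if_cong)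
  finally have total:
    "(\<Sum>l<n. \<Sum>k<n. \<Sum>j<n. c k l * (\<delta> j (\<delta> l (p k)) * c i j)) +
     (\<Sum>l<n. \<Sum>k<n. \<Sum>j<n. c k l * (\<delta> j (p k) * \<delta> l (c i j))) = (\<Sum>l<n. c i l * \<delta> l J)"
    by (simp add: distrib_left sum.distrib sum_distrib_left)
  have "(\<Sum>l<n. \<Sum>k<n. \<Sum>j<n. c k l * (\<delta> j (\<delta> l (p k)) * c i j)) =
      (\<Sum>j<n. \<Sum>k<n. \<Sum>l<n. c k l * (\<delta> j (\<delta> l (p k)) * c i j))"
    by (rule sum_reverse_3)
  also have "\<dots> = (\<Sum>j<n. c i j * \<delta> j J)"
    by (simp add: jacobi sum_distrib_left mult_ac)
  finally have "(\<Sum>l<n. \<Sum>k<n. \<Sum>j<n. c k l * (\<delta> j (p k) * \<delta> l (c i j))) = 0"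
    using total by simp
  moreover have "(\<Sum>l<n. \<Sum>k<n. \<Sum>j<n. c k l * (\<delta> j (p k) * \<delta> l (c i j))) =
      (\<Sum>l<n. \<Sum>j<n. (\<Sum>k<n. c k l * \<delta> j (p k)) * \<delta> l (c i j))"
    unfolding sum_distrib_right mult.assoc by (intro sum.cong refl sum.swap)
  moreover have "\<dots> = J * (\<Sum>l<n. \<delta> l (c i l))"
    by (simp add: col if_distrib[of "\<lambda>x. x * _"] sum_distrib_left cong: if_cong)
  ultimately show ?thesis using det by (simp add: J_def c_def)
qed

section \<open>A monomial order\<close>

text \<open>
Any linear order on the variables makes the ring of polynomials an integral domain. This is what
the kernel vector of a singular matrix and the product \<open>J A \<noteq> 0\<close> rest on.
\<close>

instantiation var :: linorder
begin

primrec var_code :: "var \<Rightarrow> nat" where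
  "var_code (X i) = 2 * i" | "var_code (Y i) = 2 * i + 1"

definition less_eq_var where "u \<le> v \<longleftrightarrow> var_code u \<le> var_code v"
definition less_var where "u < v \<longleftrightarrow> var_code u < var_code v"

instance
proof
  have inj: "u = v" if "var_code u = var_code v" for u v
    using that by (cases u; cases v) (auto, presburger+)
  fix u v w :: var
  show "u \<le> v \<Longrightarrow> v \<le> u \<Longrightarrow> u = v" by (rule inj) (simp add: less_eq_var_def)
qed (auto simp: less_eq_var_def less_var_def)

end

section \<open>Systems with an isolated zero\<close>

lemma derivation_partial_deriv: "derivation (partial_deriv v)"
  by standard (simp_all add: partial_deriv_add partial_deriv_mult)

lemma partial_deriv_sum: "partial_deriv v (\<Sum>k\<in>K. f k) = (\<Sum>k\<in>K. partial_deriv v (f k))"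
  by (rule derivation.sum[OF derivation_partial_deriv])

lemma eval_cpoly_scale:
  assumes "homogeneous_in V d p" "p \<in> polys_over V" "finite V"
  shows "eval_cpoly (\<lambda>v. c * z v) p = c ^ d * eval_cpoly z p"
proof -
  have "(\<Prod>v\<in>Poly_Mapping.keys \<mu>. (c * z v) ^ Poly_Mapping.lookup \<mu> v) =
      c ^ d * (\<Prod>v\<in>Poly_Mapping.keys \<mu>. z v ^ Poly_Mapping.lookup \<mu> v)"
    if "\<mu> \<in> Poly_Mapping.keys p" for \<mu>
  proof -
    have "Poly_Mapping.keys \<mu> \<subseteq> V" using that assms(2) unfolding polys_over_def by blast
    then have "(\<Sum>v\<in>Poly_Mapping.keys \<mu>. Poly_Mapping.lookup \<mu> v) = degree_in V \<mu>"
      unfolding degree_in_def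
      by (intro sum.mono_neutral_left assms(3)) (auto simp: in_keys_iff)
    also have "\<dots> = d" using that assms(1) unfolding homogeneous_in_def by blast
    finally show ?thesis
      by (simp add: power_mult_distrib prod.distrib power_sum[symmetric])
  qed
  then show ?thesis by (simp add: eval_cpoly_def sum_distrib_left mult_ac)
qed

lemma continuous_on_eval_cpoly: "continuous_on UNIV (\<lambda>z. eval_cpoly z p)"
proof (induction p rule: cpoly_induct)
  case (monomial \<mu> c)
  show ?case
    by (simp add: eval_monomial_def continuous_on_mult continuous_on_prod continuous_on_power)
qed (simp_all add: continuous_on_add)

locale isolated_zero_system =
  fixes N d :: nat and P :: "nat \<Rightarrow> var cpoly"
  assumes d_pos: "d \<ge> 1"
    and P_over: "\<And>i. i \<le> N \<Longrightarrow> P i \<in> polys_over (X_vars N)"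
    and P_hom: "\<And>i. i \<le> N \<Longrightarrow> homogeneous_in (X_vars N) d (P i)"
    and P_zero: "\<And>z :: var \<Rightarrow> complex.
           (\<forall>i\<le>N. eval_cpoly z (P i) = 0) \<longleftrightarrow> (\<forall>j\<le>N. z (X j) = 0)"
begin

lemma finite_X_vars [simp]: "finite (X_vars N)"
  by (simp add: X_vars_def)

lemma sum_X_vars: "(\<Sum>v\<in>X_vars N. f v) = (\<Sum>j\<le>N. f (X j))"
  unfolding X_vars_def by (subst sum.reindex) (auto simp: inj_on_def)

lemma sum_Y_vars: "(\<Sum>v\<in>Y_vars N. f v) = (\<Sum>j\<le>N. f (Y j))"
  unfolding Y_vars_def by (subst sum.reindex) (auto simp: inj_on_def)

text \<open>
Both sides scale with the factor \<open>|t|\<^bsup>2d\<^esup>\<close> if \<open>X\<close> is multiplied by \<open>t\<close>, so it suffices to look at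
the unit sphere. It is compact, and the right hand side has no zero on it, hence a positive minimum.
\<close>

lemma system_lower_bound:
  "\<exists>c>0. \<forall>z. c * (\<Sum>j\<le>N. (norm (z (X j)))\<^sup>2) ^ d \<le> (\<Sum>i\<le>N. (norm (eval_cpoly z (P i)))\<^sup>2)"
proof -
  define r where "r z = (\<Sum>j\<le>N. (norm (z (X j)))\<^sup>2)" for z :: "var \<Rightarrow> complex"
  define q where "q z = (\<Sum>i\<le>N. (norm (eval_cpoly z (P i)))\<^sup>2)" for z
  define K where "K = Pi\<^sub>E UNIV (\<lambda>v. if v \<in> X_vars N then cball 0 1 else {0}) \<inter> {z. r z = 1}"
  have cont_r: "continuous_on UNIV r"
    unfolding r_def by (intro continuous_intros) simp_all
  have cont_q: "continuous_on UNIV q"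
    unfolding q_def by (intro continuous_intros continuous_on_eval_cpoly)
  have "compactin (product_topology (\<lambda>v. euclidean) UNIV)
      (Pi\<^sub>E UNIV (\<lambda>v :: var. if v \<in> X_vars N then cball 0 1 else {0 :: complex}))"
    by (subst compactin_PiE) auto
  then have "compact (Pi\<^sub>E UNIV (\<lambda>v :: var. if v \<in> X_vars N then cball 0 1 else {0 :: complex}))"
    by (simp add: euclidean_product_topology)
  moreover have "closed {z. r z = 1}"
    using cont_r by (intro closed_Collect_eq) (auto intro: continuous_intros)
  ultimately have K: "compact K" unfolding K_def by (rule compact_Int_closed)
  have "(\<lambda>v. if v = X 0 then 1 else 0) \<in> K"
    by (auto simp: K_def r_def X_vars_def if_distrib[of norm] if_distrib[of "\<lambda>x. x\<^sup>2"] sum.delta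
          cong: if_cong)
  then have "K \<noteq> {}" by auto
  then obtain z0 where z0: "z0 \<in> K" "\<And>z. z \<in> K \<Longrightarrow> q z0 \<le> q z"
    using continuous_attains_inf[OF K _ continuous_on_subset[OF cont_q]] by blast
  have "q z0 \<ge> 0" by (auto simp: q_def sum_nonneg)
  moreover have "q z0 \<noteq> 0"
  proof
    assume "q z0 = 0"
    then have "\<forall>i\<le>N. eval_cpoly z0 (P i) = 0"
      by (auto simp: q_def sum_nonneg_eq_0_iff)
    then have "r z0 = 0" using P_zero[of z0] by (simp add: r_def)
    then show False using z0(1) by (simp add: K_def)
  qed
  ultimately have pos: "q z0 > 0" by simp
  have "q z0 * r z ^ d \<le> q z" for z
  proof (cases "r z = 0")
    case True
    then show ?thesis using d_pos by (auto simp: q_def sum_nonneg power_0_left)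
  next
    case False
    then have "r z > 0" by (simp add: r_def sum_nonneg less_le)
    define s where "s = sqrt (r z)"
    have s: "s > 0" "s\<^sup>2 = r z" using \<open>r z > 0\<close> by (auto simp: s_def)
    define y where "y v = (if v \<in> X_vars N then of_real (1 / s) * z v else 0)" for v
    have "norm (y (X j)) ^ 2 = norm (z (X j)) ^ 2 / r z" if "j \<le> N" for j
      using that s by (simp add: y_def X_vars_def norm_mult norm_divide power_divide)
    then have "r y = 1"
      using \<open>r z > 0\<close> by (simp add: r_def flip: sum_divide_distrib)
    moreover have "norm (y v) \<le> 1" if v: "v \<in> X_vars N" for v
    proof -
      obtain j where j: "v = X j" "j \<le> N" using v by (auto simp: X_vars_def)
      then have "(norm (y v))\<^sup>2 \<le> r y"
        unfolding r_def using member_le_sum[of j "{..N}" "\<lambda>j. (norm (y (X j)))\<^sup>2"] by simp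
      then show ?thesis using \<open>r y = 1\<close> by (simp add: abs_square_le_1)
    qed
    ultimately have "y \<in> K" by (auto simp: K_def) (simp add: y_def)
    have "norm (eval_cpoly y (P i)) ^ 2 * r z ^ d = norm (eval_cpoly z (P i)) ^ 2" if "i \<le> N" for i
    proof -
      have "eval_cpoly z (P i) = eval_cpoly (\<lambda>v. of_real s * y v) (P i)"
        by (rule eval_cpoly_cong[OF P_over[OF that]]) (use s in \<open>auto simp: y_def\<close>)
      also have "\<dots> = of_real s ^ d * eval_cpoly y (P i)"
        by (rule eval_cpoly_scale[OF P_hom[OF that] P_over[OF that]]) simp
      finally have "norm (eval_cpoly z (P i)) = s ^ d * norm (eval_cpoly y (P i))"
        using s(1) by (simp add: norm_mult norm_power)
      then show ?thesis
        by (simp add: power_mult_distrib flip: s(2) power_mult) (simp add: mult.commute)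
    qed
    then have "q z = q y * r z ^ d"
      by (simp add: q_def sum_distrib_right)
    then show ?thesis
      using z0(2)[OF \<open>y \<in> K\<close>] \<open>r z > 0\<close> by (simp add: mult_right_mono)
  qed
  then show ?thesis using pos unfolding q_def r_def by blast
qed

text \<open>
The exponent of the weight is \<open>-|P(X)|\<^sup>2\<close> for the variables \<open>X\<^sub>0, ..., X\<^sub>N\<close>, and the standard
Gaussian one for all others.
\<close>

definition Q :: "var \<Rightarrow> var cpoly" where
  "Q v = (case v of X i \<Rightarrow> if i \<le> N then P i else Var v | Y i \<Rightarrow> Var v)"

lemma Q_X [simp]: "i \<le> N \<Longrightarrow> Q (X i) = P i"
  by (simp add: Q_def)

lemma Q_other: "v \<notin> X_vars N \<Longrightarrow> Q v = Var v"
  by (cases v) (auto simp: Q_def X_vars_def)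

lemma Q_Y [simp]: "Q (Y i) = Var (Y i)"
  by (simp add: Q_def)

text \<open>
With \<open>R = |X|\<^sup>2\<close>, coercivity follows from \<open>|P(X)|\<^sup>2 \<ge> c R\<^sup>d \<ge> c (R - 1)\<close>; here \<open>d \<ge> 1\<close> enters.
\<close>

lemma gaussian_pairing_Q:
  assumes W: "finite W" "X_vars N \<subseteq> W"
  shows "gaussian_pairing W Q"
proof
  show "finite W" by (rule W)
  obtain c where "c > 0" and
    c: "\<And>z. c * (\<Sum>j\<le>N. (norm (z (X j)))\<^sup>2) ^ d \<le> (\<Sum>i\<le>N. (norm (eval_cpoly z (P i)))\<^sup>2)"
    using system_lower_bound by blast
  have "min c 1 * (\<Sum>v\<in>W. (norm (z v))\<^sup>2) \<le> c + (\<Sum>v\<in>W. (norm (eval_cpoly z (Q v)))\<^sup>2)" for z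
  proof -
    define R where "R = (\<Sum>j\<le>N. (norm (z (X j)))\<^sup>2)"
    define T where "T = (\<Sum>v\<in>W - X_vars N. (norm (z v))\<^sup>2)"
    have "R \<ge> 0" "T \<ge> 0" by (auto simp: R_def T_def sum_nonneg)
    have split: "(\<Sum>v\<in>W. f v) = (\<Sum>j\<le>N. f (X j)) + (\<Sum>v\<in>W - X_vars N. f v)" for f :: "var \<Rightarrow> real"
      using sum.subset_diff[OF W(2,1), of f] by (simp add: sum_X_vars)
    have "R - 1 \<le> R ^ d"
    proof (cases "R \<ge> 1")
      case True
      then show ?thesis using self_le_power[of R d] d_pos by simp
    next
      case False
      then show ?thesis using zero_le_power[OF \<open>R \<ge> 0\<close>, of d] by linarith
    qed
    then have "c * (R - 1) \<le> c * R ^ d" using \<open>c > 0\<close> by simp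
    also have "\<dots> \<le> (\<Sum>i\<le>N. (norm (eval_cpoly z (P i)))\<^sup>2)" unfolding R_def by (rule c)
    finally have "c * R \<le> c + (\<Sum>i\<le>N. (norm (eval_cpoly z (P i)))\<^sup>2)" by (simp add: algebra_simps)
    moreover have "min c 1 * R \<le> c * R" "min c 1 * T \<le> 1 * T"
      using \<open>R \<ge> 0\<close> \<open>T \<ge> 0\<close> by (intro mult_right_mono; simp)+
    moreover have "(\<Sum>v\<in>W. (norm (eval_cpoly z (Q v)))\<^sup>2) = (\<Sum>i\<le>N. (norm (eval_cpoly z (P i)))\<^sup>2) + T"
      by (simp add: split T_def Q_other)
    moreover have "(\<Sum>v\<in>W. (norm (z v))\<^sup>2) = R + T" by (simp add: split R_def T_def)
    ultimately show ?thesis by (simp add: distrib_left)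
  qed
  then show "\<exists>c>0. \<exists>C. \<forall>z. (\<forall>v. v \<notin> W \<longrightarrow> z v = 0) \<longrightarrow>
      c * (\<Sum>v\<in>W. (norm (z v))\<^sup>2) \<le> C + (\<Sum>v\<in>W. (norm (eval_cpoly z (Q v)))\<^sup>2)"
    using \<open>c > 0\<close> by (intro exI[of _ "min c 1"] conjI exI[of _ c]) auto
qed

definition occurring :: "var cpoly \<Rightarrow> var set" where
  "occurring p = (\<Union>\<mu>\<in>Poly_Mapping.keys p. Poly_Mapping.keys \<mu>)"

lemma finite_occurring [simp]: "finite (occurring p)"
  by (simp add: occurring_def)

lemma polys_over_occurring: "occurring p \<subseteq> W \<Longrightarrow> p \<in> polys_over W"
  by (auto simp: occurring_def polys_over_def)

text \<open>
The adjoint of a polynomial vector field \<open>\<Sum>\<^sub>j f\<^sub>j \<partial>/\<partial>X\<^sub>j\<close>, written in divergence form. Only the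
derivatives of the \<open>P\<^sub>k\<close> along the field enter, because the field does not see the other
variables.
\<close>

lemma integration_by_parts_field:
  assumes W: "finite W" "X_vars N \<subseteq> W"
  shows "gaussian_pairing.pairing W Q (\<Sum>j\<le>N. partial_deriv (X j) (f j * a)) b =
    (\<Sum>k\<le>N. gaussian_pairing.pairing W Q (a * (\<Sum>j\<le>N. f j * partial_deriv (X j) (P k))) (P k * b))"
proof -
  interpret gaussian_pairing W Q by (rule gaussian_pairing_Q[OF W])
  have XW: "X j \<in> W" if "j \<le> N" for j using that W(2) by (auto simp: X_vars_def)
  have "pairing (\<Sum>j\<le>N. partial_deriv (X j) (f j * a)) b =
      (\<Sum>j\<le>N. \<Sum>v\<in>W. pairing (f j * a * partial_deriv (X j) (Q v)) (Q v * b))"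
    by (simp add: pairing_sum_left integration_by_parts XW)
  also have "\<dots> = (\<Sum>v\<in>W. pairing (a * (\<Sum>j\<le>N. f j * partial_deriv (X j) (Q v))) (Q v * b))"
    by (subst sum.swap) (simp add: sum_distrib_left pairing_sum_left mult_ac)
  also have "\<dots> = (\<Sum>v\<in>X_vars N. pairing (a * (\<Sum>j\<le>N. f j * partial_deriv (X j) (Q v))) (Q v * b))"
  proof (intro sum.mono_neutral_right W ballI)
    fix v assume "v \<in> W - X_vars N"
    then have "partial_deriv (X j) (Q v) = 0" if "j \<le> N" for j
      using that by (auto simp: Q_other partial_deriv_Var X_vars_def)
    then show "pairing (a * (\<Sum>j\<le>N. f j * partial_deriv (X j) (Q v))) (Q v * b) = 0" by simp
  qed
  finally show ?thesis by (simp add: sum_X_vars)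
qed

section \<open>The Jacobian determinant\<close>

definition jacobian :: "var cpoly mat" where
  "jacobian = mat (Suc N) (Suc N) (\<lambda>(k, j). partial_deriv (X j) (P k))"

lemma jacobian_carrier: "jacobian \<in> carrier_mat (Suc N) (Suc N)"
  by (simp add: jacobian_def)

lemma jacobian_index [simp]: "k \<le> N \<Longrightarrow> j \<le> N \<Longrightarrow> jacobian $$ (k, j) = partial_deriv (X j) (P k)"
  by (simp add: jacobian_def)

text \<open>
A singular Jacobian matrix has a polynomial kernel vector \<open>f \<noteq> 0\<close>. The field \<open>\<Sum>\<^sub>j f\<^sub>j \<partial>/\<partial>X\<^sub>j\<close> then
annihilates every \<open>P\<^sub>k\<close>, so \<open>\<Sum>\<^sub>j \<partial>(f\<^sub>j a)/\<partial>X\<^sub>j\<close> is orthogonal to all polynomials, itself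
included, and vanishes for every \<open>a\<close>. Taking \<open>a = 1\<close> and \<open>a = X\<^sub>l\<close> gives \<open>f\<^sub>l = 0\<close>.
\<close>

lemma det_jacobian_nonzero: "det jacobian \<noteq> 0"
proof
  assume "det jacobian = 0"
  then obtain f where f: "f \<in> carrier_vec (Suc N)" "f \<noteq> 0\<^sub>v (Suc N)"
      "jacobian *\<^sub>v f = 0\<^sub>v (Suc N)"
    using det_0_iff_vec_prod_zero[OF jacobian_carrier] by auto
  have kernel: "(\<Sum>j\<le>N. f $ j * partial_deriv (X j) (P k)) = 0" if "k \<le> N" for k
  proof -
    have "(jacobian *\<^sub>v f) $ k = (\<Sum>j\<le>N. f $ j * partial_deriv (X j) (P k))"
      using that f(1) jacobian_carrier
      by (simp add: scalar_prod_def atLeast0LessThan lessThan_Suc_atMost mult.commute)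
    then show ?thesis using that f(3) by simp
  qed
  have div0: "(\<Sum>j\<le>N. partial_deriv (X j) (f $ j * a)) = 0" (is "?s = 0") for a
  proof -
    \<comment> \<open>The vector \<open>f\<close> may contain any variables, so \<open>W\<close> is chosen after it.\<close>
    let ?W = "X_vars N \<union> occurring ?s"
    have W: "finite ?W" "X_vars N \<subseteq> ?W" by auto
    interpret gaussian_pairing ?W Q by (rule gaussian_pairing_Q[OF W])
    have "pairing ?s ?s = 0"
      by (simp add: integration_by_parts_field[OF W] kernel)
    then show ?thesis by (rule pairing_self_eq_0_imp) (auto intro: polys_over_occurring)
  qed
  have "f $ l = 0" if "l \<le> N" for l
  proof -
    have "0 = (\<Sum>j\<le>N. partial_deriv (X j) (f $ j * Var (X l)))" by (simp add: div0)
    also have "\<dots> = (\<Sum>j\<le>N. partial_deriv (X j) (f $ j)) * Var (X l) +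
        (\<Sum>j\<le>N. f $ j * partial_deriv (X j) (Var (X l)))"
      by (simp add: partial_deriv_mult sum.distrib sum_distrib_right)
    also have "(\<Sum>j\<le>N. f $ j * partial_deriv (X j) (Var (X l))) = f $ l"
      using that by (simp add: partial_deriv_Var if_distrib cong: if_cong)
    also have "(\<Sum>j\<le>N. partial_deriv (X j) (f $ j)) = 0" using div0[of 1] by simp
    finally show ?thesis by simp
  qed
  then have "f = 0\<^sub>v (Suc N)" using f(1) by (intro eq_vecI) auto
  then show False using f(2) by simp
qed

abbreviation cof :: "nat \<Rightarrow> nat \<Rightarrow> var cpoly" where "cof \<equiv> cofactor jacobian"

abbreviation J :: "var cpoly" where "J \<equiv> det jacobian"

text \<open>
This is \<open>J \<partial>/\<partial>z\<^sub>i\<close> in the coordinates \<open>z = P(X)\<close>.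
\<close>

definition adj_field :: "nat \<Rightarrow> var cpoly \<Rightarrow> var cpoly" where
  "adj_field i a = (\<Sum>j\<le>N. cof i j * partial_deriv (X j) a)"

lemma adj_field_P: "i \<le> N \<Longrightarrow> k \<le> N \<Longrightarrow> adj_field i (P k) = (if k = i then J else 0)"
  using sum_row_cofactor[OF jacobian_carrier, of k i]
  by (simp add: adj_field_def lessThan_Suc_atMost mult.commute)

lemma adj_field_divergence:
  assumes "i \<le> N"
  shows "adj_field i a = (\<Sum>j\<le>N. partial_deriv (X j) (cof i j * a))"
proof -
  have "(\<Sum>j<Suc N. partial_deriv (X j) (cof i j)) = 0"
    using piola_identity[where \<delta> = "\<lambda>j. partial_deriv (X j)" and p = P and n = "Suc N" and i = i]
      det_jacobian_nonzero assms
    unfolding jacobian_def by (simp add: derivation_partial_deriv partial_deriv_commute)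
  then have "(\<Sum>j\<le>N. partial_deriv (X j) (cof i j) * a) = 0"
    by (simp add: lessThan_Suc_atMost flip: sum_distrib_right)
  then show ?thesis by (simp add: adj_field_def partial_deriv_mult sum.distrib)
qed

text \<open>
The analogue of the adjointness of \<open>\<partial>/\<partial>z\<^sub>i\<close> and multiplication by \<open>z\<^sub>i\<close>: since the field has
divergence \<open>0\<close>, integration by parts leaves only its derivatives of the \<open>P\<^sub>k\<close>.
\<close>

lemma pairing_adj_field:
  assumes W: "finite W" "X_vars N \<subseteq> W" and "i \<le> N"
  shows "gaussian_pairing.pairing W Q (adj_field i a) b = gaussian_pairing.pairing W Q (J * a) (P i * b)"
proof -
  interpret gaussian_pairing W Q by (rule gaussian_pairing_Q[OF W])
  have "pairing (adj_field i a) b = (\<Sum>k\<le>N. pairing (a * adj_field i (P k)) (P k * b))"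
    unfolding adj_field_divergence[OF \<open>i \<le> N\<close>, of a] integration_by_parts_field[OF W]
    by (simp add: adj_field_def)
  also have "\<dots> = (\<Sum>k\<le>N. if k = i then pairing (J * a) (P i * b) else 0)"
    using \<open>i \<le> N\<close> by (intro sum.cong) (auto simp: adj_field_P mult.commute)
  finally show ?thesis using \<open>i \<le> N\<close> by simp
qed

lemma pairing_Y:
  assumes W: "finite W" "X_vars N \<subseteq> W" and Y: "Y i \<in> W"
  shows "gaussian_pairing.pairing W Q (Var (Y i) * a) b =
    gaussian_pairing.pairing W Q a (partial_deriv (Y i) b)"
proof -
  interpret gaussian_pairing W Q by (rule gaussian_pairing_Q[OF W])
  have deriv: "partial_deriv (Y i) (Q v) = (if v = Y i then 1 else 0)" for v
  proof (cases "v \<in> X_vars N")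
    case True
    then show ?thesis
      by (auto simp: X_vars_def intro!: partial_deriv_not_occurring[OF P_over])
  qed (auto simp: Q_other partial_deriv_Var)
  have "pairing (partial_deriv (Y i) b) a =
      (\<Sum>v\<in>W. if v = Y i then pairing b (Var (Y i) * a) else 0)"
    unfolding integration_by_parts[OF Y]
    by (intro sum.cong) (auto simp: deriv)
  also have "\<dots> = pairing b (Var (Y i) * a)" using Y finite_W by simp
  finally show ?thesis
    using pairing_commute by (metis)
qed

section \<open>The bound on the degrees\<close>

definition D :: "var cpoly \<Rightarrow> var cpoly" where
  "D a = (\<Sum>i\<le>N. P i * partial_deriv (Y i) a)"

lemma partial_deriv_Y_P: "i \<le> N \<Longrightarrow> partial_deriv (Y k) (P i) = 0"
  by (rule partial_deriv_not_occurring[OF P_over]) (auto simp: X_vars_def)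

lemma partial_deriv_Y_cof: "i \<le> N \<Longrightarrow> j \<le> N \<Longrightarrow> partial_deriv (Y k) (cof i j) = 0"
proof (rule derivation.cofactor_eq_0[OF derivation_partial_deriv jacobian_carrier])
  fix r l assume "r < Suc N" "l < Suc N"
  then have "partial_deriv (Y k) (jacobian $$ (r, l)) = partial_deriv (X l) (partial_deriv (Y k) (P r))"
    by (simp add: partial_deriv_commute)
  then show "partial_deriv (Y k) (jacobian $$ (r, l)) = 0"
    using \<open>r < Suc N\<close> by (simp add: partial_deriv_Y_P)
qed auto

lemma adj_field_add: "adj_field i (a + b) = adj_field i a + adj_field i b"
  by (simp add: adj_field_def partial_deriv_add distrib_left sum.distrib)

lemma adj_field_mult: "adj_field i (a * b) = adj_field i a * b + a * adj_field i b"
  by (simp add: adj_field_def partial_deriv_mult distrib_left sum.distrib sum_distrib_left sum_distrib_right mult_ac)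

lemma adj_field_sum: "adj_field i (\<Sum>k\<in>K. f k) = (\<Sum>k\<in>K. adj_field i (f k))"
  by (induction K rule: infinite_finite_induct) (auto simp: adj_field_add, simp_all add: adj_field_def)

lemma D_mult: "D (a * b) = D a * b + a * D b"
  by (simp add: D_def partial_deriv_mult distrib_left sum.distrib sum_distrib_left sum_distrib_right mult_ac)

lemma D_sum: "D (\<Sum>k\<in>K. f k) = (\<Sum>k\<in>K. D (f k))"
  unfolding D_def partial_deriv_sum sum_distrib_left by (rule sum.swap)

lemma adj_field_partial_deriv_Y:
  "i \<le> N \<Longrightarrow> partial_deriv (Y k) (adj_field i a) = adj_field i (partial_deriv (Y k) a)"
  by (simp add: adj_field_def partial_deriv_sum partial_deriv_mult partial_deriv_Y_cof
      partial_deriv_commute[of "Y k"])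

text \<open>
The commutator of \<open>J \<partial>/\<partial>z\<^sub>j\<close> and \<open>D = \<Sum>\<^sub>i z\<^sub>i \<partial>/\<partial>Y\<^sub>i\<close> is \<open>J \<partial>/\<partial>Y\<^sub>j\<close>, because the coefficients
of the first field do not contain \<open>Y\<close>.
\<close>

lemma commutator:
  assumes "j \<le> N"
  shows "adj_field j (D a) = J * partial_deriv (Y j) a + D (adj_field j a)"
proof -
  have "adj_field j (D a) = (\<Sum>i\<le>N. adj_field j (P i) * partial_deriv (Y i) a) +
      (\<Sum>i\<le>N. P i * adj_field j (partial_deriv (Y i) a))"
    by (simp add: D_def adj_field_sum adj_field_mult sum.distrib)
  also have "(\<Sum>i\<le>N. adj_field j (P i) * partial_deriv (Y i) a) = (\<Sum>i\<le>N. if i = j then J * partial_deriv (Y j) a else 0)"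
    using assms by (intro sum.cong) (auto simp: adj_field_P)
  also have "\<dots> = J * partial_deriv (Y j) a" using assms by simp
  also have "(\<Sum>i\<le>N. P i * adj_field j (partial_deriv (Y i) a)) = D (adj_field j a)"
    using assms by (simp add: D_def adj_field_partial_deriv_Y)
  finally show ?thesis .
qed

text \<open>
Euler's relation for the \<open>P\<^sub>i\<close>, contracted with the cofactors: the Euler field in \<open>z = P(X)\<close> is
\<open>1/d\<close> times the Euler field in \<open>X\<close>.
\<close>

lemma euler_adj_field: "of_nat d * (\<Sum>i\<le>N. P i * adj_field i a) = J * (\<Sum>j\<le>N. Var (X j) * partial_deriv (X j) a)"
proof -
  have euler: "of_nat d * P i = (\<Sum>l\<le>N. Var (X l) * partial_deriv (X l) (P i))" if "i \<le> N" for i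
    using euler_identity[OF P_hom[OF that]] by (simp add: sum_X_vars)
  have "of_nat d * (\<Sum>i\<le>N. P i * adj_field i a) = (\<Sum>i\<le>N. (of_nat d * P i) * adj_field i a)"
    by (simp add: sum_distrib_left mult.assoc)
  also have "\<dots> = (\<Sum>i\<le>N. (\<Sum>l\<le>N. Var (X l) * partial_deriv (X l) (P i)) *
      (\<Sum>j\<le>N. cof i j * partial_deriv (X j) a))"
    by (intro sum.cong refl) (simp only: euler adj_field_def atMost_iff)
  also have "\<dots> = (\<Sum>i\<le>N. \<Sum>j\<le>N. \<Sum>l\<le>N.
      Var (X l) * partial_deriv (X l) (P i) * (cof i j * partial_deriv (X j) a))"
    unfolding sum_product by (intro sum.cong refl sum.swap)
  also have "\<dots> = (\<Sum>l\<le>N. \<Sum>j\<le>N. \<Sum>i\<le>N.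
      Var (X l) * partial_deriv (X l) (P i) * (cof i j * partial_deriv (X j) a))"
    by (rule sum_reverse_3)
  also have "\<dots> = (\<Sum>l\<le>N. \<Sum>j\<le>N. Var (X l) * partial_deriv (X j) a *
      (\<Sum>i\<le>N. cof i j * partial_deriv (X l) (P i)))"
    by (simp add: sum_distrib_left mult_ac)
  also have "\<dots> = (\<Sum>l\<le>N. \<Sum>j\<le>N. if j = l then Var (X l) * partial_deriv (X l) a * J else 0)"
    using sum_column_cofactor[OF jacobian_carrier]
    by (intro sum.cong refl) (auto simp: lessThan_Suc_atMost)
  finally show ?thesis by (simp add: sum_distrib_left mult_ac)
qed

text \<open>
Adjointness turns \<open>\<langle>B, B\<rangle>\<close> into \<open>\<langle>J A, D B\<rangle>\<close>, and the commutator with Euler's relation gives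
\<open>d D(B) = (n - d m) J A\<close>. As \<open>J A \<noteq> 0\<close>, positivity of the pairing forces \<open>n - d m \<ge> 0\<close>.
\<close>

lemma degree_bound:
  assumes A: "A \<in> bihomogeneous N m n" "A \<noteq> 0" "D A = 0"
  shows "d * m \<le> n"
proof -
  define B where "B = (\<Sum>i\<le>N. Var (Y i) * adj_field i A)"
  have homX: "(\<Sum>j\<le>N. Var (X j) * partial_deriv (X j) A) = of_nat n * A"
    using euler_identity[of "X_vars N" n A] A(1) by (simp add: bihomogeneous_def sum_X_vars)
  have homY: "(\<Sum>j\<le>N. Var (Y j) * partial_deriv (Y j) A) = of_nat m * A"
    using euler_identity[of "Y_vars N" m A] A(1)
    by (simp add: bihomogeneous_def sum_Y_vars) (simp add: Y_vars_def)
  have D_adj_field: "D (adj_field j A) = - (J * partial_deriv (Y j) A)" if "j \<le> N" for j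
    using commutator[OF that, of A] A(3) by (simp add: adj_field_def eq_neg_iff_add_eq_0 add.commute)
  have D_Y: "D (Var (Y j)) = P j" if "j \<le> N" for j
    using that by (simp add: D_def partial_deriv_Var if_distrib cong: if_cong)
  have "D B = (\<Sum>j\<le>N. P j * adj_field j A) + (\<Sum>j\<le>N. Var (Y j) * D (adj_field j A))"
    by (simp add: B_def D_sum D_mult D_Y sum.distrib)
  also have "(\<Sum>j\<le>N. Var (Y j) * D (adj_field j A)) = - (J * (\<Sum>j\<le>N. Var (Y j) * partial_deriv (Y j) A))"
    by (simp add: D_adj_field sum_negf sum_distrib_left mult_ac)
  finally have DB: "of_nat d * D B = of_nat n * (J * A) - of_nat (d * m) * (J * A)"
    by (simp add: right_diff_distrib euler_adj_field homX homY mult_ac)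
  let ?W = "X_vars N \<union> Y_vars N \<union> occurring (J * A)"
  have W: "finite ?W" "X_vars N \<subseteq> ?W" by (auto simp: Y_vars_def)
  interpret gaussian_pairing ?W Q by (rule gaussian_pairing_Q[OF W])
  have "pairing B B = (\<Sum>i\<le>N. pairing (Var (Y i) * adj_field i A) B)"
    by (subst (1) B_def) (rule pairing_sum_left)
  also have "\<dots> = (\<Sum>i\<le>N. pairing (J * A) (P i * partial_deriv (Y i) B))"
  proof (intro sum.cong refl)
    fix i assume "i \<in> {..N}"
    then have i: "i \<le> N" "Y i \<in> ?W" by (auto simp: Y_vars_def)
    show "pairing (Var (Y i) * adj_field i A) B = pairing (J * A) (P i * partial_deriv (Y i) B)"
      using pairing_Y[OF W i(2)] pairing_adj_field[OF W i(1)] by metis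
  qed
  also have "\<dots> = pairing (J * A) (D B)" by (simp add: D_def pairing_sum_right)
  finally have "of_nat d * pairing B B = pairing (J * A) (of_nat d * D B)"
    by (simp add: pairing_of_nat_right)
  also have "\<dots> = (of_nat n - of_nat (d * m)) * pairing (J * A) (J * A)"
    unfolding DB pairing_diff_right pairing_of_nat_right by (simp add: left_diff_distrib)
  finally have key: "real d * Re (pairing B B) = (real n - real (d * m)) * Re (pairing (J * A) (J * A))"
    by (simp add: complex_eq_iff pairing_self)
  have "J * A \<noteq> 0" using det_jacobian_nonzero A(2) by simp
  then have "pairing (J * A) (J * A) \<noteq> 0"
    using pairing_self_eq_0_imp[of "J * A"] polys_over_occurring[of "J * A" ?W] by auto
  then have "Re (pairing (J * A) (J * A)) > 0"
    using Re_pairing_self_nonneg[of "J * A"] by (simp add: pairing_self less_le)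
  moreover have "(real n - real (d * m)) * Re (pairing (J * A) (J * A)) \<ge> 0"
    unfolding key[symmetric] using Re_pairing_self_nonneg by simp
  ultimately have "real (d * m) \<le> real n" by (simp add: zero_le_mult_iff)
  then show ?thesis by (simp only: of_nat_le_iff)
qed

section \<open>Existence of solutions\<close>

lemma bihomogeneous_mult:
  assumes "a \<in> bihomogeneous N m n" "b \<in> bihomogeneous N m' n'"
  shows "a * b \<in> bihomogeneous N (m + m') (n + n')"
proof -
  have deg: "degree_in V (\<mu> + \<nu>) = degree_in V \<mu> + degree_in V \<nu>" for V :: "var set" and \<mu> \<nu>
    by (simp add: degree_in_def lookup_add sum.distrib)
  have keys: "\<exists>\<mu>\<in>Poly_Mapping.keys a. \<exists>\<nu>\<in>Poly_Mapping.keys b. \<rho> = \<mu> + \<nu>"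
    if "\<rho> \<in> Poly_Mapping.keys (a * b)" for \<rho>
    using that Poly_Mapping.keys_mult[of a b] by blast
  have "homogeneous_in V (k + l) (a * b)" if "homogeneous_in V k a" "homogeneous_in V l b" for V k l
    unfolding homogeneous_in_def
  proof
    fix \<rho> assume "\<rho> \<in> Poly_Mapping.keys (a * b)"
    then obtain \<mu> \<nu> where "\<mu> \<in> Poly_Mapping.keys a" "\<nu> \<in> Poly_Mapping.keys b" "\<rho> = \<mu> + \<nu>"
      using keys by blast
    then show "degree_in V \<rho> = k + l" using that by (simp add: deg homogeneous_in_def)
  qed
  moreover have "a * b \<in> polys_over V" if "a \<in> polys_over V" "b \<in> polys_over V" for V
    unfolding polys_over_def
  proof safe
    fix \<rho> v assume "\<rho> \<in> Poly_Mapping.keys (a * b)" "v \<in> Poly_Mapping.keys \<rho>"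
    then obtain \<mu> \<nu> where \<mu>\<nu>: "\<mu> \<in> Poly_Mapping.keys a" "\<nu> \<in> Poly_Mapping.keys b" "\<rho> = \<mu> + \<nu>"
      using keys by blast
    then have "v \<in> Poly_Mapping.keys \<mu> \<union> Poly_Mapping.keys \<nu>"
      using \<open>v \<in> Poly_Mapping.keys \<rho>\<close> Poly_Mapping.keys_add[of \<mu> \<nu>] by blast
    then show "v \<in> V" using that \<mu>\<nu>(1,2) unfolding polys_over_def by blast
  qed
  ultimately show ?thesis using assms by (simp add: bihomogeneous_def)
qed

lemma bihomogeneous_1: "1 \<in> bihomogeneous N 0 0"
  by (auto simp: bihomogeneous_def polys_over_def homogeneous_in_def degree_in_def)

lemma bihomogeneous_power: "a \<in> bihomogeneous N m n \<Longrightarrow> a ^ k \<in> bihomogeneous N (k * m) (k * n)"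
  by (induction k) (auto simp: bihomogeneous_1 intro: bihomogeneous_mult)

lemma bihomogeneous_diff:
  assumes "a \<in> bihomogeneous N m n" "b \<in> bihomogeneous N m n"
  shows "a - b \<in> bihomogeneous N m n"
proof -
  have "Poly_Mapping.keys (a - b) \<subseteq> Poly_Mapping.keys a \<union> Poly_Mapping.keys b"
    by (auto simp: in_keys_iff lookup_minus)
  then show ?thesis
    using assms unfolding bihomogeneous_def polys_over_def homogeneous_in_def by blast
qed

lemma bihomogeneous_Var_X: "i \<le> N \<Longrightarrow> Var (X i) \<in> bihomogeneous N 0 1"
  and bihomogeneous_Var_Y: "i \<le> N \<Longrightarrow> Var (Y i) \<in> bihomogeneous N 1 0"
  by (auto simp: bihomogeneous_def polys_over_def homogeneous_in_def degree_in_def Var_def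
      X_vars_def Y_vars_def lookup_single when_def sum.reindex inj_on_def)

lemma bihomogeneous_P:
  assumes "i \<le> N"
  shows "P i \<in> bihomogeneous N 0 d"
proof -
  have "degree_in (Y_vars N) \<mu> = 0" if "\<mu> \<in> Poly_Mapping.keys (P i)" for \<mu>
  proof -
    have "Poly_Mapping.keys \<mu> \<subseteq> X_vars N"
      using that P_over[OF assms] unfolding polys_over_def by blast
    then have "Poly_Mapping.lookup \<mu> v = 0" if "v \<in> Y_vars N" for v
    proof -
      have "v \<notin> X_vars N" using that by (auto simp: X_vars_def Y_vars_def)
      then have "v \<notin> Poly_Mapping.keys \<mu>" using \<open>Poly_Mapping.keys \<mu> \<subseteq> X_vars N\<close> by blast
      then show ?thesis by (simp add: in_keys_iff)
    qed
    then show ?thesis by (simp add: degree_in_def)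
  qed
  then have "homogeneous_in (Y_vars N) 0 (P i)" by (simp add: homogeneous_in_def)
  moreover have "P i \<in> polys_over (Y_vars N \<union> X_vars N)"
    using P_over[OF assms] unfolding polys_over_def by blast
  ultimately show ?thesis using P_hom[OF assms] by (simp add: bihomogeneous_def)
qed

text \<open>
Some \<open>P\<^sub>i\<close> does not vanish at the point \<open>X = (1, 0, ..., 0)\<close>. Evaluating there with \<open>Y\<^sub>j = 1\<close> and
\<open>Y\<^sub>i = 0\<close> shows \<open>P\<^sub>i Y\<^sub>j - P\<^sub>j Y\<^sub>i \<noteq> 0\<close>.
\<close>

lemma exists_solution:
  assumes "N \<ge> 1" "d * m \<le> n"
  shows "\<exists>A\<in>bihomogeneous N m n. A \<noteq> 0 \<and> D A = 0"
proof -
  define z where "z v = (if v = X 0 then 1 else 0 :: complex)" for v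
  have "z (X 0) \<noteq> 0" by (simp add: z_def)
  then obtain i where i: "i \<le> N" "eval_cpoly z (P i) \<noteq> 0"
    using P_zero[of z] by blast
  obtain j where j: "j \<le> N" "j \<noteq> i"
    using \<open>N \<ge> 1\<close> that[of 0] that[of 1] by (cases "i = 0") auto
  define G where "G = P i * Var (Y j) - P j * Var (Y i)"
  have "G \<noteq> 0"
  proof
    define z' where "z' = z(Y j := 1)"
    assume "G = 0"
    then have "eval_cpoly z' G = 0" by simp
    moreover have "eval_cpoly z' (P k) = eval_cpoly z (P k)" if "k \<le> N" for k
      by (rule eval_cpoly_cong[OF P_over[OF that]]) (auto simp: z'_def X_vars_def)
    ultimately show False using i j by (simp add: G_def z'_def z_def)
  qed
  have "G \<in> bihomogeneous N 1 d"
    unfolding G_def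
    using bihomogeneous_mult[OF bihomogeneous_P bihomogeneous_Var_Y] i(1) j(1)
    by (intro bihomogeneous_diff) auto
  then have "G ^ m * Var (X 0) ^ (n - d * m) \<in>
      bihomogeneous N (m * 1 + (n - d * m) * 0) (m * d + (n - d * m) * 1)"
    by (intro bihomogeneous_mult bihomogeneous_power bihomogeneous_Var_X) auto
  then have "G ^ m * Var (X 0) ^ (n - d * m) \<in> bihomogeneous N m n"
    using assms(2) by (simp add: mult.commute)
  moreover have "Var (X 0) \<noteq> (0 :: var cpoly)"
    by (metis eval_cpoly_Var eval_cpoly_0 \<open>z (X 0) \<noteq> 0\<close>)
  then have "G ^ m * Var (X 0) ^ (n - d * m) \<noteq> 0" using \<open>G \<noteq> 0\<close> by simp
  moreover have D: "derivation D"
    by standard (simp_all add: D_mult, simp add: D_def partial_deriv_add distrib_left sum.distrib)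
  have D_Y: "D (Var (Y k)) = P k" if "k \<le> N" for k
    using that by (simp add: D_def partial_deriv_Var if_distrib cong: if_cong)
  have D_P: "D (P k) = 0" if "k \<le> N" for k
    using that by (simp add: D_def partial_deriv_Y_P)
  have "D G = 0"
    using i j by (simp add: G_def derivation.diff[OF D] D_mult D_Y D_P)
  then have "D (G ^ m * Var (X 0) ^ (n - d * m)) = 0"
    by (simp add: D_mult derivation.power_eq_0[OF D] D_def[of "Var (X 0)"] partial_deriv_Var)
  ultimately show ?thesis by blast
qed

end

theorem theorem0p0p2:
  fixes N d m n :: nat and P :: "nat \<Rightarrow> var cpoly"
  assumes "N \<ge> 2" and "d \<ge> 1"
    and "\<And>i. i \<le> N \<Longrightarrow> P i \<in> polys_over (X_vars N)"
    and "\<And>i. i \<le> N \<Longrightarrow> homogeneous_in (X_vars N) d (P i)"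
    and "\<And>z :: var \<Rightarrow> complex.
           (\<forall>i\<le>N. eval_cpoly z (P i) = 0) \<longleftrightarrow> (\<forall>j\<le>N. z (X j) = 0)"
  shows "(\<exists>A\<in>bihomogeneous N m n. A \<noteq> 0 \<and> (\<Sum>i\<le>N. P i * partial_deriv (Y i) A) = 0)
           \<longleftrightarrow> d * m \<le> n"
proof -
  interpret isolated_zero_system N d P by standard (use assms in auto)
  show ?thesis
    using degree_bound exists_solution assms(1) unfolding D_def by force
qed

end
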